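(* Let $m\ge 1$ be an integer and let $(a_n)_{n\in\mathbb{Z}}$, $(b_n)_{n\in\mathbb{Z}}$ be $p$-periodic sequences of real $m\times m$ matrices with $a_n>0$ (positive definite) and $b_n=b_n^*$ for all $n\in\mathbb{Z}$. Let $J$ be the associated Jacobi operator, $J^0$ the unperturbed Jacobi operator, $c=\det\prod_{n=1}^p a_n$, and for $\tau\in\mathbb{C}$, $|\tau|=1$, let $\lambda_1(\tau),\dots,\lambda_{pm}(\tau)$ be the eigenvalues of $K_p(\tau)$ (all as defined in the context). (i) Let $c=1$. Then $\sum_{n=1}^{mp}\lambda_n^2(\tau)=2pm$ for some $\tau\in\mathbb{C}$ with $|\tau|=1$ if and only if $J=J^0$. (ii) Let $c=1$ and let $\varkappa_1\in\mathbb{R}$. Then the eigenvalues of $K_p(e^{i\varkappa_1})$ (suitably numbered) are $$\lambda_s(e^{i\varkappa_1})=2\cos\frac{\varkappa_1+2\pi(s-1)}{p}\quad\text{for all } s=1,\dots,mp,$$ if and only if $J=J^0$. (iii) Let $\varkappa_1,\varkappa_2\in\mathbb{R}$ and $\cos\varkappa_1\neq\cos\varkappa_2$ (here $c=1$ is not assumed). Then the following two conditions both hold if and only if $J=J^0$: (a) the eigenvalues of $K_p(e^{i\varkappa_1})$ (suitably numbered) are $\lambda_s(e^{i\varkappa_1})=2\cos\frac{\varkappa_1+2\pi(s-1)}{p}$ for all $s=1,\dots,mp$; (b) for some $n_1\in\{1,\dots,p\}$, the eigenvalues of $K_p(e^{i\varkappa_2})$ (suitably numbered) satisfy $\lambda_n(e^{i\varkappa_2})=2\cos\frac{\varkappa_2+2\pi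 n_1}{p}$ for $n=1,\dots,m$, and, if $e^{2i\varkappa_2}=1$, then additionally $\lambda_{n+m}(e^{i\varkappa_2})=\lambda_1(e^{i\varkappa_2})\neq\pm 2$ for $n=1,\dots,m$.
   Context: The Jacobi operator $J$ acts on $\ell^2(\mathbb{Z})^m$ by $$(Jy)_n=a_ny_{n+1}+b_ny_n+a_{n-1}y_{n-1},\qquad n\in\mathbb{Z},\quad y_n\in\mathbb{C}^m,\ y=(y_n)_{n\in\mathbb{Z}}\in\ell^2(\mathbb{Z})^m.$$ $J^0$ is the Jacobi operator with coefficients $a_n^0=I_m$ and $b_n^0=0$ for all $n$, where $I_m$ is the $m\times m$ identity matrix; thus $J=J^0$ means $a_n=I_m$ and $b_n=0$ for all $n\in\mathbb{Z}$. For $\tau\in\mathbb{C}$ with $|\tau|=1$, $K_p(\tau)$ is the $pm\times pm$ matrix, written in $m\times m$ blocks, given by $$K_p(\tau)=\begin{pmatrix} b_1 & a_1 & 0 & \cdots & \tau^{-1}a_p\\ a_1 & b_2 & a_2 & \cdots & 0\\ 0 & a_2 & b_3 & \cdots & 0\\ \vdots & \vdots & \vdots & \ddots & \vdots\\ \tau a_p & 0 & \cdots & a_{p-1} & b_p\end{pmatrix}.$$ Its eigenvalues, listed with multiplicity, are denoted $\lambda_1(\tau),\dots,\lambda_{pm}(\tau)$; no ordering is imposed on the numbering.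
   Formalization: The formal theorem assumes period p ≥ 3; for p ≤ 2 the displayed matrix K_p(τ) is undefined since its corner blocks overlap other blocks, and if overlapping blocks are added, (i) fails (p=2, m=1, b=0, τ=-1, a_1-a_2=√2, a_1a_2=1). *)

theory Defs
  imports
    "HOL-Analysis.Infinite_Sum"
    "HOL-Library.FuncSet"
    "Jordan_Normal_Form.Char_Poly"
begin

abbreviation cmat :: "real mat \<Rightarrow> complex mat" where
  "cmat \<equiv> map_mat complex_of_real"

definition positive_definite :: "nat \<Rightarrow> real mat \<Rightarrow> bool" where
  "positive_definite m A \<longleftrightarrow> A \<in> carrier_mat m m \<and> transpose_mat A = A \<and>
     (\<forall>v \<in> carrier_vec m. v \<noteq> 0\<^sub>v m \<longrightarrow> v \<bullet> (A *\<^sub>v v) > 0)"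

definition self_adjoint :: "nat \<Rightarrow> real mat \<Rightarrow> bool" where
  "self_adjoint m A \<longleftrightarrow> A \<in> carrier_mat m m \<and> transpose_mat A = A"

text \<open>The space $\ell^2(\mathbb{Z})^m$: every coordinate sequence is square summable.\<close>

definition l2_seqs :: "nat \<Rightarrow> (int \<Rightarrow> complex vec) set" where
  "l2_seqs m = {y. (\<forall>n. y n \<in> carrier_vec m) \<and>
     (\<forall>i<m. (\<lambda>n. (cmod (y n $ i))\<^sup>2) summable_on UNIV)}"

text \<open>The operator is restricted to \<^term>\<open>l2_seqs m\<close> (with the value \<^term>\<open>undefined\<close> elsewhere),
  so that equality of two such functions is equality of operators on $\ell^2(\mathbb{Z})^m$.\<close>

definition jacobi_op ::
  "nat \<Rightarrow> (int \<Rightarrow> real mat) \<Rightarrow> (int \<Rightarrow> real mat) \<Rightarrow> (int \<Rightarrow> complex vec) \<Rightarrow> (int \<Rightarrow> complex vec)" where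
  "jacobi_op m a b = restrict
     (\<lambda>y n. cmat (a n) *\<^sub>v y (n + 1) + cmat (b n) *\<^sub>v y n + cmat (a (n - 1)) *\<^sub>v y (n - 1))
     (l2_seqs m)"

definition free_jacobi_op :: "nat \<Rightarrow> (int \<Rightarrow> complex vec) \<Rightarrow> (int \<Rightarrow> complex vec)" where
  "free_jacobi_op m = jacobi_op m (\<lambda>n. 1\<^sub>m m) (\<lambda>n. 0\<^sub>m m m)"

definition period_product :: "nat \<Rightarrow> nat \<Rightarrow> (int \<Rightarrow> real mat) \<Rightarrow> real mat" where
  "period_product m p a = foldr (\<lambda>n P. a n * P) [1..int p] (1\<^sub>m m)"

text \<open>The block in block row \<open>r\<close> and block column \<open>s\<close>, both counted from \<open>1\<close>.
  The cases are mutually exclusive as soon as \<open>p \<ge> 3\<close>; for \<open>p \<le> 2\<close> the corners would overlap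
  the diagonal or the off-diagonals, and the definition is not meant to be used there.\<close>

definition K_block ::
  "nat \<Rightarrow> nat \<Rightarrow> (int \<Rightarrow> real mat) \<Rightarrow> (int \<Rightarrow> real mat) \<Rightarrow> complex \<Rightarrow> nat \<Rightarrow> nat \<Rightarrow> complex mat" where
  "K_block m p a b \<tau> r s =
     (if r = s then cmat (b (int r))
      else if s = r + 1 then cmat (a (int r))
      else if r = s + 1 then cmat (a (int s))
      else if r = 1 \<and> s = p then inverse \<tau> \<cdot>\<^sub>m cmat (a (int p))
      else if r = p \<and> s = 1 then \<tau> \<cdot>\<^sub>m cmat (a (int p))
      else 0\<^sub>m m m)"

definition K_mat ::
  "nat \<Rightarrow> nat \<Rightarrow> (int \<Rightarrow> real mat) \<Rightarrow> (int \<Rightarrow> real mat) \<Rightarrow> complex \<Rightarrow> complex mat" where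
  "K_mat m p a b \<tau> = mat (p * m) (p * m)
     (\<lambda>(i, j). K_block m p a b \<tau> (i div m + 1) (j div m + 1) $$ (i mod m, j mod m))"

text \<open>\<open>lam 1, \<dots>, lam N\<close> (with \<open>N\<close> the size of \<open>A\<close>) is a list of all eigenvalues of \<open>A\<close>, repeated
  according to multiplicity, in some order.\<close>

definition eigenvalue_numbering :: "complex mat \<Rightarrow> (nat \<Rightarrow> complex) \<Rightarrow> bool" where
  "eigenvalue_numbering A lam \<longleftrightarrow> char_poly A = (\<Prod>n = 1..dim_row A. [:- lam n, 1:])"

lemma jacobi_op_eq_free_iff:
  assumes a: "\<And>n. a n \<in> carrier_mat m m" and b: "\<And>n. b n \<in> carrier_mat m m"
  shows "jacobi_op m a b = free_jacobi_op m \<longleftrightarrow> (\<forall>n. a n = 1\<^sub>m m \<and> b n = 0\<^sub>m m m)"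
proof
  assume eq: "jacobi_op m a b = free_jacobi_op m"
  define d :: "int \<Rightarrow> nat \<Rightarrow> int \<Rightarrow> complex vec"
    where "d = (\<lambda>k j n. if n = k then unit_vec m j else 0\<^sub>v m)"
  have dc: "d k j n \<in> carrier_vec m" for k j n
    by (simp add: d_def)
  have dl: "d k j \<in> l2_seqs m" for k j
  proof -
    have "(\<lambda>n. (cmod (d k j n $ i))\<^sup>2) summable_on UNIV" if "i < m" for i
    proof -
      have "(\<lambda>n. (cmod (d k j n $ i))\<^sup>2) summable_on {k}" by simp
      then show ?thesis
        by (rule summable_on_cong_neutral[THEN iffD1, rotated -1]) (use that in \<open>auto simp: d_def\<close>)
    qed
    then show ?thesis using dc by (auto simp: l2_seqs_def)
  qed
  have E: "cmat (a n) *\<^sub>v d k j (n + 1) + cmat (b n) *\<^sub>v d k j n + cmat (a (n - 1)) *\<^sub>v d k j (n - 1)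
         = cmat (1\<^sub>m m) *\<^sub>v d k j (n + 1) + cmat (0\<^sub>m m m) *\<^sub>v d k j n
           + cmat (1\<^sub>m m) *\<^sub>v d k j (n - 1)" for n k j
    using fun_cong[OF fun_cong[OF eq, of "d k j"], of n] dl[of k j]
    by (simp add: jacobi_op_def free_jacobi_op_def)
  have z: "cmat A *\<^sub>v 0\<^sub>v m = 0\<^sub>v m" if "A \<in> carrier_mat m m" for A
    using that by (intro eq_vecI) auto
  have u: "(cmat A *\<^sub>v unit_vec m j) $ i = complex_of_real (A $$ (i, j))"
    if "A \<in> carrier_mat m m" "i < m" "j < m" for A i j
    using that by (auto simp: scalar_prod_right_unit)
  have uc: "cmat A *\<^sub>v unit_vec m j \<in> carrier_vec m" if "A \<in> carrier_mat m m" for A j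
    using that by (intro mult_mat_vec_carrier[where n = m]) auto
  show "\<forall>n. a n = 1\<^sub>m m \<and> b n = 0\<^sub>m m m"
  proof (intro allI conjI eq_matI)
    fix n i j assume "i < dim_row (1\<^sub>m m :: real mat)" "j < dim_col (1\<^sub>m m :: real mat)"
    then have ij: "i < m" "j < m" by auto
    have cA: "cmat (a n) *\<^sub>v unit_vec m j \<in> carrier_vec m" "cmat (1\<^sub>m m) *\<^sub>v unit_vec m j \<in> carrier_vec m"
      using uc[OF a[of n]] uc[OF one_carrier_mat] by blast+
    have "cmat (a n) *\<^sub>v unit_vec m j = cmat (1\<^sub>m m) *\<^sub>v unit_vec m j"
      using E[of n "n + 1" j] a b cA by (simp add: d_def z del: of_real_hom.mat_hom_one)
    from arg_cong[OF this, of "\<lambda>v. v $ i"] show "a n $$ (i, j) = 1\<^sub>m m $$ (i, j)"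
      using u[OF a ij, of n] u[OF one_carrier_mat ij] by (metis of_real_eq_iff)
  next
    fix n i j assume "i < dim_row (0\<^sub>m m m :: real mat)" "j < dim_col (0\<^sub>m m m :: real mat)"
    then have ij: "i < m" "j < m" by auto
    have cB: "cmat (b n) *\<^sub>v unit_vec m j \<in> carrier_vec m" "cmat (0\<^sub>m m m) *\<^sub>v unit_vec m j \<in> carrier_vec m"
      using uc[OF b[of n]] uc[OF zero_carrier_mat] by blast+
    have "cmat (b n) *\<^sub>v unit_vec m j = cmat (0\<^sub>m m m) *\<^sub>v unit_vec m j"
      using E[of n n j] a b cB by (simp add: d_def z)
    from arg_cong[OF this, of "\<lambda>v. v $ i"] show "b n $$ (i, j) = 0\<^sub>m m m $$ (i, j)"
      using u[OF b ij, of n] u[OF zero_carrier_mat ij] by (metis of_real_eq_iff)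
  qed (use a b in \<open>auto\<close>)
next
  assume "\<forall>n. a n = 1\<^sub>m m \<and> b n = 0\<^sub>m m m"
  then have "a = (\<lambda>n. 1\<^sub>m m)" "b = (\<lambda>n. 0\<^sub>m m m)" by auto
  then show "jacobi_op m a b = free_jacobi_op m"
    by (simp add: free_jacobi_op_def)
qed

end

theory Submission
  imports Defs "Jordan_Normal_Form.Schur_Decomposition"
begin

text \<open>
  Everything is read off from two quantities attached to the matrices $K_p(\tau)$.

  The first is the trace of $K_p(\tau)^2$. For $p \ge 3$ and $|\tau| = 1$ it equals
  $\sum_n (\|b_n\|^2 + 2\|a_n\|^2)$ in the Frobenius norm, whatever $\tau$ is. A positive definite
  $m \times m$ matrix $a$ with eigenvalues $x_i$ satisfies
  $\|a\|^2 = \sum_i x_i^2 \ge \sum_i (1 + 2 \ln x_i) = m + 2 \ln \det a$, with equality only for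
  $a = I$. If $c = 1$, summing over a period shows that the trace is at least $2pm$, and
  that it equals $2pm$ only for the free coefficients. This is part (i), and
  part (ii) follows because equal spectra have equal sums of squares. The lemmas are
  \<open>log_det_inequality\<close>, \<open>K_square_sum\<close> and \<open>free_if_trace_sq_minimal\<close>. The spectrum of
  the free matrix itself comes from an explicit diagonalization by Fourier modes (\<open>char_poly_K_free\<close>).

  In part (iii) it remains to derive $c = 1$. Fix a real $\mu$. Up to a factor of modulus $1$, the
  number $\det(\mu - K_p(1/\epsilon))$ is on the unit circle the value at $\epsilon$ of a polynomial
  $h$ of degree at most $2m$ with $|h(0)| = c$. If $\mu$ is an eigenvalue of the Hermitian matrix
  $K_p(e^{i\varkappa_2})$ of multiplicity at least $m$ (or $2m$, when $e^{i\varkappa_2} = \pm 1$), then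
  $h$ vanishes at $e^{\pm i\varkappa_2}$ to so high an order that
  $h = C (\epsilon^2 - 2\epsilon\cos\varkappa_2 + 1)^m$ with $|C| = c$. Hence
  $|\det(\mu - K_p(e^{i\varkappa}))| = c\,|2\cos\varkappa - 2\cos\varkappa_2|^m$ for all real
  $\varkappa$ (\<open>norm_char_poly_at_full_multiplicity\<close>). The free operator satisfies the same
  identity with $c = 1$ and with the same left-hand side at $\varkappa = \varkappa_1$, where the
  spectra agree. As $\cos\varkappa_1 \ne \cos\varkappa_2$, this gives $c = 1$, and part (ii) applies.
\<close>

section \<open>Linear algebra of complex matrices\<close>

lemma index_mult_mat_sum:
  assumes "A \<in> carrier_mat n n" "B \<in> carrier_mat n n" "i < n" "j < n"
  shows "(A * B) $$ (i, j) = (\<Sum>k<n. A $$ (i, k) * B $$ (k, j))"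
  using assms by (auto simp: scalar_prod_def lessThan_atLeast0 intro!: sum.cong)

lemma index_mult_mat_vec_sum:
  assumes "A \<in> carrier_mat n n" "v \<in> carrier_vec n" "i < n"
  shows "(A *\<^sub>v v) $ i = (\<Sum>k<n. A $$ (i, k) * v $ k)"
  using assms by (auto simp: scalar_prod_def lessThan_atLeast0 intro!: sum.cong)

lemma trace_mult_comm:
  fixes A B :: "'a :: comm_ring_1 mat"
  assumes "A \<in> carrier_mat n n" "B \<in> carrier_mat n n"
  shows "(\<Sum>i<n. (A * B) $$ (i, i)) = (\<Sum>i<n. (B * A) $$ (i, i))"
proof -
  have "(\<Sum>i<n. (A * B) $$ (i, i)) = (\<Sum>i<n. \<Sum>k<n. A $$ (i, k) * B $$ (k, i))"
    by (intro sum.cong refl index_mult_mat_sum assms) auto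
  also have "\<dots> = (\<Sum>k<n. \<Sum>i<n. B $$ (k, i) * A $$ (i, k))"
    by (subst sum.swap) (simp add: mult.commute)
  also have "\<dots> = (\<Sum>k<n. (B * A) $$ (k, k))"
    by (intro sum.cong refl index_mult_mat_sum[symmetric] assms) auto
  finally show ?thesis .
qed

lemma schur_triangularization:
  fixes A :: "complex mat"
  assumes A: "A \<in> carrier_mat n n" and es: "char_poly A = (\<Prod>e\<leftarrow>es. [:- e, 1:])"
  obtains B P Q where "B \<in> carrier_mat n n" "P \<in> carrier_mat n n" "Q \<in> carrier_mat n n"
    "P * Q = 1\<^sub>m n" "Q * P = 1\<^sub>m n" "A = P * B * Q"
    "\<And>i j. j < i \<Longrightarrow> i < n \<Longrightarrow> B $$ (i, j) = 0"
    "length es = n" "\<And>i. i < n \<Longrightarrow> B $$ (i, i) = es ! i"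
proof -
  obtain B P Q where s: "schur_decomposition A es = (B, P, Q)"
    by (cases "schur_decomposition A es")
  from schur_decomposition[OF A es s]
  have w: "similar_mat_wit A B P Q" and u: "upper_triangular B" and d: "diag_mat B = es" by auto
  note W = similar_mat_witD2[OF A w]
  have "length es = n" using d W by (auto simp: diag_mat_def)
  moreover have "B $$ (i, i) = es ! i" if "i < n" for i
    using d W that by (auto simp: diag_mat_def)
  moreover have "B $$ (i, j) = 0" if "j < i" "i < n" for i j
    using u W that by (auto simp: upper_triangular_def)
  ultimately show ?thesis using W that by blast
qed

text \<open>Both sides are the trace of $A^2$: the right-hand side directly, the left-hand side after passing
  to a similar upper triangular matrix.\<close>

lemma sum_list_eigenvalue_squares:
  fixes A :: "complex mat"
  assumes A: "A \<in> carrier_mat n n" and es: "char_poly A = (\<Prod>e\<leftarrow>es. [:- e, 1:])"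
  shows "(\<Sum>e\<leftarrow>es. e\<^sup>2) = (\<Sum>i<n. \<Sum>j<n. A $$ (i, j) * A $$ (j, i))"
proof -
  obtain B P Q where B: "B \<in> carrier_mat n n" and P: "P \<in> carrier_mat n n"
    and Q: "Q \<in> carrier_mat n n" and PQ: "P * Q = 1\<^sub>m n" and QP: "Q * P = 1\<^sub>m n"
    and eq: "A = P * B * Q"
    and ut: "\<And>i j. j < i \<Longrightarrow> i < n \<Longrightarrow> B $$ (i, j) = 0"
    and len: "length es = n" and d: "\<And>i. i < n \<Longrightarrow> B $$ (i, i) = es ! i"
    by (rule schur_triangularization[OF A es]) blast
  have PB: "P * B \<in> carrier_mat n n" and BQ: "B * Q \<in> carrier_mat n n" and BB: "B * B \<in> carrier_mat n n"
    using P B Q by auto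
  have "A * A = P * B * (Q * (P * B * Q))"
    unfolding eq by (rule assoc_mult_mat[OF PB Q]) (use P B Q in auto)
  also have "Q * (P * B * Q) = Q * (P * (B * Q))"
    using P B Q by (simp add: assoc_mult_mat[OF P B Q])
  also have "\<dots> = B * Q"
    unfolding assoc_mult_mat[OF Q P BQ, symmetric] QP by (rule left_mult_one_mat[OF BQ])
  finally have AA: "A * A = P * B * (B * Q)" .
  have "(\<Sum>i<n. \<Sum>j<n. A $$ (i, j) * A $$ (j, i)) = (\<Sum>i<n. (A * A) $$ (i, i))"
    by (intro sum.cong refl index_mult_mat_sum[symmetric] A) auto
  also have "\<dots> = (\<Sum>i<n. (B * Q * (P * B)) $$ (i, i))"
    unfolding AA by (rule trace_mult_comm[OF PB BQ])
  also have "B * Q * (P * B) = B * (Q * (P * B))"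
    by (rule assoc_mult_mat[OF B Q PB])
  also have "Q * (P * B) = B"
    unfolding assoc_mult_mat[OF Q P B, symmetric] QP by (rule left_mult_one_mat[OF B])
  also have "(\<Sum>i<n. (B * B) $$ (i, i)) = (\<Sum>i<n. (es ! i)\<^sup>2)"
  proof (rule sum.cong[OF refl])
    fix i assume "i \<in> {..<n}"
    then have i: "i < n" by simp
    have "(B * B) $$ (i, i) = (\<Sum>k<n. B $$ (i, k) * B $$ (k, i))"
      by (rule index_mult_mat_sum[OF B B i i])
    also have "\<dots> = (\<Sum>k<n. if k = i then (es ! i)\<^sup>2 else 0)"
    proof (rule sum.cong[OF refl])
      fix k assume "k \<in> {..<n}"
      then show "B $$ (i, k) * B $$ (k, i) = (if k = i then (es ! i)\<^sup>2 else 0)"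
        using ut[of k i] ut[of i k] i d[OF i]
        by (cases k i rule: linorder_cases) (auto simp: power2_eq_square)
    qed
    also have "\<dots> = (es ! i)\<^sup>2" using i by simp
    finally show "(B * B) $$ (i, i) = (es ! i)\<^sup>2" .
  qed
  also have "\<dots> = (\<Sum>e\<leftarrow>es. e\<^sup>2)"
    by (simp add: sum_list_sum_nth len lessThan_atLeast0)
  finally show ?thesis by simp
qed

lemma det_eq_prod_eigenvalues:
  fixes A :: "complex mat"
  assumes A: "A \<in> carrier_mat n n" and es: "char_poly A = (\<Prod>e\<leftarrow>es. [:- e, 1:])"
  shows "det A = prod_list es"
proof -
  obtain B P Q where s: "schur_decomposition A es = (B, P, Q)"
    by (cases "schur_decomposition A es")
  from schur_decomposition[OF A es s]
  have w: "similar_mat_wit A B P Q" and u: "upper_triangular B" and d: "diag_mat B = es" by auto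
  have "det A = det B" using w by (intro det_similar) (auto simp: similar_mat_def)
  also have "\<dots> = prod_list es"
    using det_upper_triangular[OF u similar_mat_witD2(5)[OF A w]] d by simp
  finally show ?thesis .
qed

lemma char_poly_splits_with_multiplicity:
  fixes A :: "complex mat"
  assumes A: "A \<in> carrier_mat n n" and dvd: "[:- \<mu>, 1:] ^ N dvd char_poly A"
  obtains es where "char_poly A = (\<Prod>e\<leftarrow>replicate N \<mu> @ es. [:- e, 1:])" "N + length es = n"
proof -
  obtain q where q: "char_poly A = [:- \<mu>, 1:] ^ N * q" using dvd by (elim dvdE)
  have mon: "monic (char_poly A)" and deg: "degree (char_poly A) = n"
    using degree_monic_char_poly[OF A] by auto
  have lq: "coeff q (degree q) = 1"
    using mon unfolding q lead_coeff_mult lead_coeff_power by simp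
  from fundamental_theorem_algebra_factorized[of q] obtain es
    where "Polynomial.smult (coeff q (degree q)) (\<Prod>a\<leftarrow>es. [:- a, 1:]) = q" by blast
  then have "char_poly A = (\<Prod>e\<leftarrow>replicate N \<mu> @ es. [:- e, 1:])"
    using q lq by (simp add: prod_list_replicate)
  moreover from this have "N + length es = n"
    using degree_linear_factors[of uminus "replicate N \<mu> @ es"] deg by simp
  ultimately show ?thesis using that by blast
qed

definition hermitian :: "nat \<Rightarrow> complex mat \<Rightarrow> bool" where
  "hermitian n A \<longleftrightarrow> A \<in> carrier_mat n n \<and> (\<forall>i<n. \<forall>j<n. A $$ (j, i) = cnj (A $$ (i, j)))"

text \<open>With $w = Mv$ one has $\|w\|^2 = \langle Mv, w\rangle = \langle v, Mw\rangle = 0$.\<close>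

lemma hermitian_kernel_square:
  assumes M: "hermitian n M" and v: "v \<in> carrier_vec n" and z: "M *\<^sub>v (M *\<^sub>v v) = 0\<^sub>v n"
  shows "M *\<^sub>v v = 0\<^sub>v n"
proof -
  have Mc: "M \<in> carrier_mat n n" and Mh: "\<And>i j. i < n \<Longrightarrow> j < n \<Longrightarrow> M $$ (j, i) = cnj (M $$ (i, j))"
    using M unfolding hermitian_def by blast+
  define w where "w = M *\<^sub>v v"
  have w: "w \<in> carrier_vec n" using Mc v by (auto simp: w_def)
  have wi: "w $ i = (\<Sum>j<n. M $$ (i, j) * v $ j)" if "i < n" for i
    unfolding w_def by (rule index_mult_mat_vec_sum[OF Mc v that])
  have "(\<Sum>i<n. cnj (w $ i) * w $ i) = (\<Sum>i<n. \<Sum>j<n. cnj (M $$ (i, j)) * cnj (v $ j) * w $ i)"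
  proof (rule sum.cong[OF refl])
    fix i assume "i \<in> {..<n}"
    then have "cnj (w $ i) = (\<Sum>j<n. cnj (M $$ (i, j)) * cnj (v $ j))" by (simp add: wi)
    then show "cnj (w $ i) * w $ i = (\<Sum>j<n. cnj (M $$ (i, j)) * cnj (v $ j) * w $ i)"
      by (simp only: sum_distrib_right)
  qed
  also have "\<dots> = (\<Sum>j<n. \<Sum>i<n. cnj (v $ j) * (M $$ (j, i) * w $ i))"
    by (subst sum.swap, intro sum.cong refl) (simp add: Mh[symmetric])
  also have "\<dots> = (\<Sum>j<n. cnj (v $ j) * (M *\<^sub>v w) $ j)"
    by (intro sum.cong refl) (simp add: index_mult_mat_vec_sum[OF Mc w] sum_distrib_left del: index_mult_mat_vec)
  also have "\<dots> = 0" unfolding w_def z by simp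
  finally have "(\<Sum>i<n. complex_of_real ((cmod (w $ i))\<^sup>2)) = 0"
    by (simp only: complex_norm_square mult.commute)
  then have "(\<Sum>i<n. (cmod (w $ i))\<^sup>2) = 0"
    by (simp only: of_real_sum[symmetric] of_real_eq_0_iff)
  then have "\<forall>i<n. w $ i = 0" by (subst (asm) sum_nonneg_eq_0_iff) auto
  then show ?thesis using w unfolding w_def[symmetric] by (intro eq_vecI) auto
qed

text \<open>For a Hermitian matrix the algebraic multiplicity of an eigenvalue is also its geometric multiplicity.
  In the basis of a Schur form that lists $\mu$ first, $A - \mu$ maps the basis vector number $j < N$
  to a combination of earlier ones, which by induction are eigenvectors. So $(A - \mu)^2$ kills
  this vector, and then $A - \mu$ does. The eigenvectors are delivered as the first
  columns of an invertible matrix because this form feeds into a determinant.\<close>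

lemma hermitian_multiplicity_columns:
  assumes A: "hermitian n A" and dvd: "[:- complex_of_real \<mu>, 1:] ^ N dvd char_poly A"
  obtains P where "P \<in> carrier_mat n n" "det P \<noteq> 0" "N \<le> n"
    "\<And>i j. i < n \<Longrightarrow> j < N \<Longrightarrow> (\<Sum>k<n. A $$ (i, k) * P $$ (k, j)) = complex_of_real \<mu> * P $$ (i, j)"
proof -
  have Ac: "A \<in> carrier_mat n n" using A unfolding hermitian_def by blast
  obtain fs where fs: "char_poly A = (\<Prod>e\<leftarrow>replicate N (complex_of_real \<mu>) @ fs. [:- e, 1:])"
    and Nn: "N + length fs = n"
    using char_poly_splits_with_multiplicity[OF Ac dvd] .
  define es where "es = replicate N (complex_of_real \<mu>) @ fs"
  obtain B P Q where B: "B \<in> carrier_mat n n" and P: "P \<in> carrier_mat n n"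
    and Q: "Q \<in> carrier_mat n n" and PQ: "P * Q = 1\<^sub>m n" and QP: "Q * P = 1\<^sub>m n"
    and eq: "A = P * B * Q"
    and ut: "\<And>i j. j < i \<Longrightarrow> i < n \<Longrightarrow> B $$ (i, j) = 0"
    and len: "length es = n" and d: "\<And>i. i < n \<Longrightarrow> B $$ (i, i) = es ! i"
    by (rule schur_triangularization[OF Ac fs, folded es_def]) blast
  define M where "M = A - complex_of_real \<mu> \<cdot>\<^sub>m 1\<^sub>m n"
  define T where "T = B - complex_of_real \<mu> \<cdot>\<^sub>m 1\<^sub>m n"
  have Mc: "M \<in> carrier_mat n n" and Tc: "T \<in> carrier_mat n n"
    unfolding M_def T_def using Ac B by auto
  have Mh: "hermitian n M"
    unfolding hermitian_def
  proof (intro conjI allI impI)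
    fix i j assume ij: "i < n" "j < n"
    then have "A $$ (j, i) = cnj (A $$ (i, j))" using A unfolding hermitian_def by blast
    then show "M $$ (j, i) = cnj (M $$ (i, j))"
      using ij Ac by (cases "i = j") (simp_all add: M_def)
  qed (rule Mc)
  have "A * P = P * B * (Q * P)"
    unfolding eq by (rule assoc_mult_mat) (use P B Q in auto)
  then have AP: "A * P = P * B" using QP P B by simp
  have "M * P = A * P - complex_of_real \<mu> \<cdot>\<^sub>m P"
    unfolding M_def using Ac P
    by (simp add: minus_mult_distrib_mat[of A n n] mult_smult_assoc_mat[of "1\<^sub>m n" n n P n])
  also have "\<dots> = P * T"
    unfolding T_def AP using P B by (simp add: mult_minus_distrib_mat[of P n n B n] mult_smult_distrib[of P n n "1\<^sub>m n" n])
  finally have MP: "M * P = P * T" .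
  have T0: "T $$ (k, j) = 0" if "j \<le> k" "j < N" "k < n" for k j
    using that Nn ut[of j k] d[of k] B by (auto simp: T_def es_def nth_append)
  have K: "M *\<^sub>v col P j = 0\<^sub>v n" if "j < N" for j
    using that
  proof (induction j rule: less_induct)
    case (less j)
    have jn: "j < n" using less.prems Nn by simp
    have cP: "col P j \<in> carrier_vec n" and cT: "col T j \<in> carrier_vec n"
      using P Tc by auto
    have "M *\<^sub>v col P j = col (M * P) j"
      by (rule col_mult2[OF Mc P jn, symmetric])
    also have "\<dots> = P *\<^sub>v col T j"
      unfolding MP by (rule col_mult2[OF P Tc jn])
    finally have "M *\<^sub>v (M *\<^sub>v col P j) = (M * P) *\<^sub>v col T j"
      using assoc_mult_mat_vec[OF Mc P cT] by simp
    also have "\<dots> = 0\<^sub>v n"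
    proof (rule eq_vecI)
      fix i assume "i < dim_vec (0\<^sub>v n :: complex vec)"
      then have i: "i < n" by simp
      have MPc: "M * P \<in> carrier_mat n n" using Mc P by simp
      have "(M * P *\<^sub>v col T j) $ i = (\<Sum>k<n. (M * P) $$ (i, k) * col T j $ k)"
        by (rule index_mult_mat_vec_sum[OF MPc cT i])
      also have "\<dots> = 0"
      proof (rule sum.neutral, rule ballI)
        fix k assume "k \<in> {..<n}"
        then have k: "k < n" by simp
        show "(M * P) $$ (i, k) * col T j $ k = 0"
        proof (cases "k < j")
          case True
          then have "col (M * P) k = 0\<^sub>v n"
            using less(1)[OF True] less.prems col_mult2[OF Mc P k] True by simp
          from arg_cong[OF this, of "\<lambda>v. v $ i"] have "col (M * P) k $ i = 0" using i by simp
          moreover have "col (M * P) k $ i = (M * P) $$ (i, k)"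
            using i k Mc P by (subst index_col) auto
          ultimately show ?thesis by simp
        next
          case False
          then show ?thesis using T0[of j k] less.prems k jn Tc by simp
        qed
      qed
      finally show "(M * P *\<^sub>v col T j) $ i = 0\<^sub>v n $ i" using i by simp
    qed (use Mc in auto)
    finally show ?case by (rule hermitian_kernel_square[OF Mh cP])
  qed
  have "(\<Sum>k<n. A $$ (i, k) * P $$ (k, j)) = complex_of_real \<mu> * P $$ (i, j)"
    if "i < n" "j < N" for i j
  proof -
    have jn: "j < n" using that Nn by simp
    have "0 = (M *\<^sub>v col P j) $ i" using K[OF that(2)] that by simp
    also have "\<dots> = (\<Sum>k<n. M $$ (i, k) * col P j $ k)"
      by (rule index_mult_mat_vec_sum[OF Mc _ that(1)]) (use P in auto)
    also have "\<dots> = (\<Sum>k<n. A $$ (i, k) * P $$ (k, j) - (if k = i then complex_of_real \<mu> * P $$ (i, j) else 0))"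
      using that jn P Ac by (intro sum.cong refl) (auto simp: M_def algebra_simps)
    also have "\<dots> = (\<Sum>k<n. A $$ (i, k) * P $$ (k, j)) - complex_of_real \<mu> * P $$ (i, j)"
      using that by (simp add: sum_subtractf)
    finally show ?thesis by simp
  qed
  moreover have "det P \<noteq> 0"
  proof
    assume "det P = 0"
    then show False using det_mult[OF P Q] PQ by simp
  qed
  moreover have "N \<le> n" using Nn by simp
  ultimately show ?thesis using P by (intro that)
qed

text \<open>A matrix polynomial whose kernel at $\epsilon$ has dimension at least $N$ has a determinant vanishing
  there to order at least $N$: multiplying by an invertible constant matrix whose first $N$
  columns lie in that kernel makes $N$ whole columns divisible by $X - \epsilon$.\<close>

lemma det_root_multiplicity:
  fixes H :: "complex poly mat"
  assumes H: "H \<in> carrier_mat n n" and P: "P \<in> carrier_mat n n" and dP: "det P \<noteq> 0" and N: "N \<le> n"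
    and z: "\<And>i j. i < n \<Longrightarrow> j < N \<Longrightarrow> (\<Sum>k<n. poly (H $$ (i, k)) \<epsilon> * P $$ (k, j)) = 0"
  shows "[:- \<epsilon>, 1:] ^ N dvd det H"
proof -
  define P' where "P' = map_mat (\<lambda>c. [:c:]) P"
  have P': "P' \<in> carrier_mat n n" using P by (simp add: P'_def)
  have detP': "det P' = [:det P:]" 
  proof -
    interpret comm_ring_hom "\<lambda>c :: complex. [:c:]" by unfold_locales auto
    show ?thesis unfolding P'_def by simp
  qed
  define G where "G = H * P'"
  have G: "G \<in> carrier_mat n n" using H P' by (simp add: G_def)
  have col: "[:- \<epsilon>, 1:] dvd G $$ (i, j)" if "i < n" "j < N" for i j
  proof -
    have jn: "j < n" using that N by simp
    have "poly (G $$ (i, j)) \<epsilon> = (\<Sum>k<n. poly (H $$ (i, k)) \<epsilon> * P $$ (k, j))"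
      unfolding G_def index_mult_mat_sum[OF H P' that(1) jn] poly_sum
      using P jn by (intro sum.cong refl) (auto simp: P'_def)
    then show ?thesis using z[OF that] by (simp add: poly_eq_0_iff_dvd)
  qed
  \<comment> \<open>The Leibniz formula runs over rows, so the transpose is used to make each summand contain one entry of every column.\<close>
  have "[:- \<epsilon>, 1:] ^ N dvd det (transpose_mat G)"
    unfolding det_def'[OF transpose_carrier_mat[THEN iffD2, OF G]]
  proof (intro dvd_sum dvd_mult)
    fix q assume "q \<in> {q. q permutes {0..<n}}"
    then have q: "q i < n" if "i < n" for i using that by (auto dest: permutes_in_image)
    have "[:- \<epsilon>, 1:] ^ N = (\<Prod>i = 0..<N. [:- \<epsilon>, 1:])" by simp
    also have "\<dots> dvd (\<Prod>i = 0..<N. transpose_mat G $$ (i, q i))"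
      by (rule prod_dvd_prod) (use col q N G in auto)
    also have "\<dots> dvd (\<Prod>i = 0..<n. transpose_mat G $$ (i, q i))"
      by (rule prod_dvd_prod_subset) (use N in auto)
    finally show "[:- \<epsilon>, 1:] ^ N dvd (\<Prod>i = 0..<n. transpose_mat G $$ (i, q i))" .
  qed
  then have "[:- \<epsilon>, 1:] ^ N dvd det H * [:det P:]"
    using det_mult[OF H P'] detP' det_transpose[OF G] by (simp add: G_def)
  then show ?thesis using dP by (simp add: dvd_smult_iff)
qed

lemma degree_det_le_sum:
  assumes A: "A \<in> carrier_mat n n"
    and d: "\<And>i j. i < n \<Longrightarrow> j < n \<Longrightarrow> degree (A $$ (i, j)) \<le> d i"
  shows "degree (det A) \<le> (\<Sum>i<n. d i)"
  unfolding det_def'[OF A]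
proof (rule degree_sum_le)
  fix q assume "q \<in> {q. q permutes {0..<n}}"
  then have q: "q i < n" if "i < n" for i using that by (auto dest: permutes_in_image)
  have "degree (\<Prod>i = 0..<n. A $$ (i, q i)) \<le> (\<Sum>i = 0..<n. degree (A $$ (i, q i)))"
    using degree_prod_sum_le[of "{0..<n}" "\<lambda>i. A $$ (i, q i)"] by (simp add: o_def)
  also have "\<dots> \<le> (\<Sum>i<n. d i)"
    unfolding lessThan_atLeast0 by (intro sum_mono d) (auto intro: q)
  finally show "degree (signof q * (\<Prod>i = 0..<n. A $$ (i, q i))) \<le> (\<Sum>i<n. d i)" by simp
qed (simp add: finite_permutations)

lemma block_index_less:
  fixes r k m i :: nat
  assumes "r < k" "i < m"
  shows "r * m + i < k * m"
proof -
  have "r * m + i < Suc r * m" using assms by simp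
  also have "\<dots> \<le> k * m" using assms by (intro mult_le_mono1) simp
  finally show ?thesis .
qed

lemma det_block_lower_triangular:
  fixes A :: "'a :: idom mat"
  assumes A: "A \<in> carrier_mat (k * m) (k * m)"
    and z: "\<And>i j. i < k * m \<Longrightarrow> j < k * m \<Longrightarrow> i div m < j div m \<Longrightarrow> A $$ (i, j) = 0"
  shows "det A = (\<Prod>r<k. det (mat m m (\<lambda>(i, j). A $$ (r * m + i, r * m + j))))"
  using assms
proof (induction k arbitrary: A)
  case 0
  then show ?case by simp
next
  case (Suc k)
  define A1 where "A1 = mat (k * m) (k * m) (\<lambda>(i, j). A $$ (i, j))"
  define A3 where "A3 = mat m (k * m) (\<lambda>(i, j). A $$ (k * m + i, j))"
  define A4 where "A4 = mat m m (\<lambda>(i, j). A $$ (k * m + i, k * m + j))"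
  have div: "i div m < k" if "i < k * m" for i
    using that less_mult_imp_div_less by blast
  have div': "i div m = k" if "i < Suc k * m" "\<not> i < k * m" for i
    using that by (intro div_nat_eqI) (auto simp: mult.commute)
  have "A = four_block_mat A1 (0\<^sub>m (k * m) m) A3 A4"
  proof (rule eq_matI)
    fix i j assume ij: "i < dim_row (four_block_mat A1 (0\<^sub>m (k * m) m) A3 A4)"
      "j < dim_col (four_block_mat A1 (0\<^sub>m (k * m) m) A3 A4)"
    then have ij': "i < Suc k * m" "j < Suc k * m" by (auto simp: A1_def A4_def)
    show "A $$ (i, j) = four_block_mat A1 (0\<^sub>m (k * m) m) A3 A4 $$ (i, j)"
      using ij ij' Suc.prems(2)[OF ij'] div[of i] div'[OF ij'(2)]
      by (auto simp: A1_def A3_def A4_def)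
  qed (use Suc.prems in \<open>auto simp: A1_def A4_def\<close>)
  then have "det A = det A1 * det A4"
    using det_four_block_mat_upper_right_zero[of A1 "k * m" "0\<^sub>m (k * m) m" m A3 A4]
    by (simp add: A1_def A3_def A4_def)
  also have "det A1 = (\<Prod>r<k. det (mat m m (\<lambda>(i, j). A1 $$ (r * m + i, r * m + j))))"
    by (rule Suc.IH) (use Suc.prems in \<open>auto simp: A1_def\<close>)
  also have "\<dots> = (\<Prod>r<k. det (mat m m (\<lambda>(i, j). A $$ (r * m + i, r * m + j))))"
  proof (intro prod.cong refl arg_cong[where f = det] cong_mat)
    fix r i j assume "r \<in> {..<k}" "i < m" "j < m"
    then have "r * m + i < k * m" "r * m + j < k * m"
      by (auto intro: block_index_less)
    then show "(\<lambda>(i, j). A1 $$ (r * m + i, r * m + j)) (i, j) = (\<lambda>(i, j). A $$ (r * m + i, r * m + j)) (i, j)"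
      by (simp add: A1_def)
  qed
  finally show ?case unfolding prod.lessThan_Suc A4_def .
qed

section \<open>Frobenius norm and determinant of positive definite matrices\<close>

definition frobenius_sq :: "nat \<Rightarrow> real mat \<Rightarrow> real" where
  "frobenius_sq m A = (\<Sum>i<m. \<Sum>j<m. (A $$ (i, j))\<^sup>2)"

lemma frobenius_sq_nonneg: "frobenius_sq m A \<ge> 0"
  by (simp add: frobenius_sq_def sum_nonneg)

lemma frobenius_sq_eq_0:
  assumes "A \<in> carrier_mat m m" "frobenius_sq m A = 0"
  shows "A = 0\<^sub>m m m"
proof (rule eq_matI)
  fix i j assume "i < dim_row (0\<^sub>m m m :: real mat)" "j < dim_col (0\<^sub>m m m :: real mat)"
  then have ij: "i < m" "j < m" by auto
  have "(\<Sum>j<m. (A $$ (i, j))\<^sup>2) = 0"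
    using assms(2) ij unfolding frobenius_sq_def
    by (subst (asm) sum_nonneg_eq_0_iff) (auto intro: sum_nonneg)
  then have "(A $$ (i, j))\<^sup>2 = 0"
    using ij by (subst (asm) sum_nonneg_eq_0_iff) auto
  then show "A $$ (i, j) = 0\<^sub>m m m $$ (i, j)" using ij by simp
qed (use assms in auto)

lemma transpose_eqD:
  assumes "A \<in> carrier_mat m m" "transpose_mat A = A" "i < m" "j < m"
  shows "A $$ (j, i) = A $$ (i, j)"
proof -
  have "transpose_mat A $$ (i, j) = A $$ (j, i)" using assms(1,3,4) by simp
  then show ?thesis by (simp add: assms(2))
qed

lemma quadratic_form_sum:
  fixes A :: "real mat" and v :: "real vec"
  assumes "A \<in> carrier_mat m m" "v \<in> carrier_vec m"
  shows "v \<bullet> (A *\<^sub>v v) = (\<Sum>i<m. \<Sum>j<m. v $ i * A $$ (i, j) * v $ j)"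
proof -
  have "v \<bullet> (A *\<^sub>v v) = (\<Sum>i<m. v $ i * (A *\<^sub>v v) $ i)"
    using assms by (auto simp: scalar_prod_def lessThan_atLeast0)
  also have "\<dots> = (\<Sum>i<m. v $ i * (\<Sum>j<m. A $$ (i, j) * v $ j))"
    by (intro sum.cong refl) (simp add: index_mult_mat_vec_sum[OF assms] del: index_mult_mat_vec)
  finally show ?thesis by (simp add: sum_distrib_left mult.assoc)
qed

text \<open>For an eigenvector $v = x + iy$ the imaginary part of $v^* A v$ cancels by symmetry, so
  $e\,\|v\|^2 = v^* A v = x^T A x + y^T A y > 0$.\<close>

lemma positive_definite_eigenvalue:
  assumes A: "positive_definite m A" and e: "eigenvalue (cmat A) e"
  obtains x where "x > 0" "e = complex_of_real x"
proof -
  have Ac: "A \<in> carrier_mat m m" and At: "transpose_mat A = A"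
    and Ap: "\<And>v. v \<in> carrier_vec m \<Longrightarrow> v \<noteq> 0\<^sub>v m \<Longrightarrow> v \<bullet> (A *\<^sub>v v) > 0"
    using A by (auto simp: positive_definite_def)
  have cA: "cmat A \<in> carrier_mat m m" using Ac by simp
  obtain v where v: "v \<in> carrier_vec m" and v0: "v \<noteq> 0\<^sub>v m" and ev: "cmat A *\<^sub>v v = e \<cdot>\<^sub>v v"
    using e cA unfolding eigenvalue_def eigenvector_def by auto
  define x where "x = vec m (\<lambda>i. Re (v $ i))"
  define y where "y = vec m (\<lambda>i. Im (v $ i))"
  have xc: "x \<in> carrier_vec m" and yc: "y \<in> carrier_vec m" by (auto simp: x_def y_def)
  have vxy: "v $ i = complex_of_real (x $ i) + \<i> * complex_of_real (y $ i)" if "i < m" for i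
    using that by (simp add: x_def y_def complex_eq_iff)
  have cross: "(\<Sum>i<m. \<Sum>j<m. y $ i * A $$ (i, j) * x $ j) = (\<Sum>i<m. \<Sum>j<m. x $ i * A $$ (i, j) * y $ j)"
    by (subst sum.swap, intro sum.cong refl) (simp add: transpose_eqD[OF Ac At])
  have "(\<Sum>i<m. cnj (v $ i) * (e * v $ i)) = (\<Sum>i<m. cnj (v $ i) * (cmat A *\<^sub>v v) $ i)"
    unfolding ev using v by (intro sum.cong refl) auto
  also have "\<dots> = (\<Sum>i<m. \<Sum>j<m. cnj (v $ i) * (complex_of_real (A $$ (i, j)) * v $ j))"
    using Ac by (intro sum.cong refl)
      (simp add: index_mult_mat_vec_sum[OF cA v] sum_distrib_left del: index_mult_mat_vec)
  also have "\<dots> = (\<Sum>i<m. \<Sum>j<m.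
      complex_of_real (x $ i * A $$ (i, j) * x $ j) + complex_of_real (y $ i * A $$ (i, j) * y $ j)
      + \<i> * (complex_of_real (x $ i * A $$ (i, j) * y $ j) - complex_of_real (y $ i * A $$ (i, j) * x $ j)))"
    by (intro sum.cong refl) (simp add: vxy algebra_simps)
  also have "\<dots> = complex_of_real (x \<bullet> (A *\<^sub>v x) + y \<bullet> (A *\<^sub>v y))"
    unfolding quadratic_form_sum[OF Ac xc] quadratic_form_sum[OF Ac yc]
      sum.distrib sum_distrib_left[symmetric] sum_subtractf of_real_sum[symmetric] cross
    by simp
  finally have 1: "(\<Sum>i<m. cnj (v $ i) * (e * v $ i)) = complex_of_real (x \<bullet> (A *\<^sub>v x) + y \<bullet> (A *\<^sub>v y))" .
  have "(\<Sum>i<m. cnj (v $ i) * (e * v $ i)) = e * (\<Sum>i<m. cnj (v $ i) * v $ i)"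
    by (simp add: sum_distrib_left algebra_simps)
  also have "(\<Sum>i<m. cnj (v $ i) * v $ i) = complex_of_real (\<Sum>i<m. (cmod (v $ i))\<^sup>2)"
    by (simp only: complex_norm_square mult.commute of_real_sum)
  finally have 2: "e * complex_of_real (\<Sum>i<m. (cmod (v $ i))\<^sup>2) = complex_of_real (x \<bullet> (A *\<^sub>v x) + y \<bullet> (A *\<^sub>v y))"
    using 1 by simp
  have "\<exists>i<m. v $ i \<noteq> 0"
  proof (rule ccontr)
    assume "\<not> (\<exists>i<m. v $ i \<noteq> 0)"
    then have "v = 0\<^sub>v m" using v by (intro eq_vecI) auto
    then show False using v0 by simp
  qed
  then obtain i where i: "i < m" "v $ i \<noteq> 0" by blast
  define s where "s = (\<Sum>i<m. (cmod (v $ i))\<^sup>2)"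
  have s: "s > 0" unfolding s_def using i by (intro sum_pos2[of _ i]) auto
  have nn: "z \<bullet> (A *\<^sub>v z) \<ge> 0" if "z \<in> carrier_vec m" for z
  proof (cases "z = 0\<^sub>v m")
    case True
    then show ?thesis using quadratic_form_sum[OF Ac that] by simp
  next
    case False
    then show ?thesis using Ap[OF that] by simp
  qed
  have "x $ i \<noteq> 0 \<or> y $ i \<noteq> 0" using i vxy[of i] by auto
  then have "x \<noteq> 0\<^sub>v m \<or> y \<noteq> 0\<^sub>v m" using i by auto
  then have q: "x \<bullet> (A *\<^sub>v x) + y \<bullet> (A *\<^sub>v y) > 0"
    using Ap[OF xc] Ap[OF yc] nn[OF xc] nn[OF yc] by (auto intro: add_pos_nonneg add_nonneg_pos)
  have "e = complex_of_real ((x \<bullet> (A *\<^sub>v x) + y \<bullet> (A *\<^sub>v y)) / s)"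
    using 2 s unfolding s_def[symmetric] by (simp add: field_simps)
  then show ?thesis using that q s by (metis divide_pos_pos)
qed

lemma hermitian_cmat:
  assumes "A \<in> carrier_mat m m" "transpose_mat A = A"
  shows "hermitian m (cmat A)"
  using assms(1) transpose_eqD[OF assms] by (simp add: hermitian_def)

text \<open>Summing $x^2 \ge 1 + 2\ln x$ (the tangent line of the logarithm at $1$, taken at $x^2$) over the
  eigenvalues gives the inequality. In the equality case all eigenvalues are $1$, and a
  diagonalizable matrix with this property is the identity.\<close>

lemma log_det_inequality:
  assumes A: "positive_definite m A"
  shows "det A > 0" and "real m + 2 * ln (det A) \<le> frobenius_sq m A"
    and "frobenius_sq m A = real m + 2 * ln (det A) \<Longrightarrow> A = 1\<^sub>m m"
proof -
  have Ac: "A \<in> carrier_mat m m" and At: "transpose_mat A = A"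
    using A by (auto simp: positive_definite_def)
  have cA: "cmat A \<in> carrier_mat m m" using Ac by simp
  obtain es where es: "char_poly (cmat A) = (\<Prod>e\<leftarrow>es. [:- e, 1:])" and len: "length es = m"
    using char_poly_factorized[OF cA] by blast
  have "\<exists>x>0. e = complex_of_real x" if "e \<in> set es" for e
  proof -
    have "poly (char_poly (cmat A)) e = 0"
      using that unfolding es poly_prod_list by (auto simp: prod_list_zero_iff image_iff)
    then have "eigenvalue (cmat A) e" using eigenvalue_root_char_poly[OF cA] by simp
    then show ?thesis using positive_definite_eigenvalue[OF A] by metis
  qed
  then obtain g where g: "\<And>e. e \<in> set es \<Longrightarrow> g e > 0 \<and> e = complex_of_real (g e)"
    by metis
  define xs where "xs = map g es"
  have xs: "es = map complex_of_real xs"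
    unfolding xs_def map_map by (rule map_idI[symmetric]) (use g in auto)
  have pos: "x > 0" if "x \<in> set xs" for x using that g by (auto simp: xs_def)
  have "complex_of_real (det A) = det (cmat A)" by simp
  also have "\<dots> = prod_list es" by (rule det_eq_prod_eigenvalues[OF cA es])
  also have "\<dots> = complex_of_real (prod_list xs)" unfolding xs by (induction xs) auto
  finally have d: "det A = prod_list xs" by (simp only: of_real_eq_iff)
  have dp: "prod_list xs > 0" and ld: "ln (prod_list xs) = (\<Sum>x\<leftarrow>xs. ln x)"
    using pos by (induction xs) (auto simp: ln_mult)
  show "det A > 0" using d dp by simp
  have "complex_of_real (\<Sum>x\<leftarrow>xs. x\<^sup>2) = (\<Sum>e\<leftarrow>es. e\<^sup>2)" unfolding xs by (induction xs) auto
  also have "\<dots> = (\<Sum>i<m. \<Sum>j<m. cmat A $$ (i, j) * cmat A $$ (j, i))"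
    by (rule sum_list_eigenvalue_squares[OF cA es])
  also have "\<dots> = complex_of_real (frobenius_sq m A)"
    unfolding frobenius_sq_def of_real_sum
    using Ac by (intro sum.cong refl) (auto simp: power2_eq_square transpose_eqD[OF Ac At])
  finally have sq: "frobenius_sq m A = (\<Sum>x\<leftarrow>xs. x\<^sup>2)" by (simp only: of_real_eq_iff)
  have lx: "length xs = m" by (simp add: xs_def len)
  have gap: "frobenius_sq m A - (real m + 2 * ln (det A)) = (\<Sum>x\<leftarrow>xs. x\<^sup>2 - 1 - 2 * ln x)"
  proof -
    have "(\<Sum>x\<leftarrow>xs. x\<^sup>2 - 1 - 2 * ln x) = (\<Sum>x\<leftarrow>xs. x\<^sup>2) - real (length xs) - 2 * (\<Sum>x\<leftarrow>xs. ln x)"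
      by (induction xs) auto
    then show ?thesis using sq d ld lx by simp
  qed
  have gap_summand: "x\<^sup>2 - 1 - 2 * ln x \<ge> 0" "x\<^sup>2 - 1 - 2 * ln x = 0 \<Longrightarrow> x = 1" if "x > 0" for x :: real
  proof -
    have l: "ln (x\<^sup>2) = 2 * ln x" using that by (simp add: ln_realpow)
    show "x\<^sup>2 - 1 - 2 * ln x \<ge> 0" using ln_le_minus_one[of "x\<^sup>2"] that l by simp
    assume "x\<^sup>2 - 1 - 2 * ln x = 0"
    then have "x\<^sup>2 = 1" using that l by (intro ln_eq_minus_one) auto
    then show "x = 1" using that by (simp add: power2_eq_1_iff)
  qed
  have "(\<Sum>x\<leftarrow>xs. x\<^sup>2 - 1 - 2 * ln x) \<ge> 0"
    using pos gap_summand by (intro sum_list_nonneg) auto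
  then show "real m + 2 * ln (det A) \<le> frobenius_sq m A" using gap by simp
  assume "frobenius_sq m A = real m + 2 * ln (det A)"
  then have "(\<Sum>x\<leftarrow>xs. x\<^sup>2 - 1 - 2 * ln x) = 0" using gap by simp
  then have "\<forall>x\<in>set xs. x\<^sup>2 - 1 - 2 * ln x = 0"
    using pos gap_summand(1) by (subst (asm) sum_list_nonneg_eq_0_iff) auto
  then have "\<forall>x\<in>set xs. x = 1" using pos gap_summand(2) by blast
  then have "xs = replicate m 1" using lx by (simp add: replicate_eqI)
  then have "char_poly (cmat A) = [:- complex_of_real 1, 1:] ^ m"
    unfolding es xs by (simp add: prod_list_replicate)
  then have dvd: "[:- complex_of_real 1, 1:] ^ m dvd char_poly (cmat A)" by simp
  obtain P where P: "P \<in> carrier_mat m m" "det P \<noteq> 0"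
    and AP: "\<And>i j. i < m \<Longrightarrow> j < m \<Longrightarrow> (\<Sum>k<m. cmat A $$ (i, k) * P $$ (k, j)) = complex_of_real 1 * P $$ (i, j)"
    by (rule hermitian_multiplicity_columns[OF hermitian_cmat[OF Ac At] dvd]) blast
  have AP': "cmat A * P = P"
  proof (rule eq_matI)
    fix i j assume "i < dim_row P" "j < dim_col P"
    then have ij: "i < m" "j < m" using P by auto
    show "(cmat A * P) $$ (i, j) = P $$ (i, j)"
      unfolding index_mult_mat_sum[OF cA P(1) ij] AP[OF ij] by simp
  qed (use cA P in auto)
  obtain Q where Q: "Q \<in> carrier_mat m m" and PQ: "P * Q = 1\<^sub>m m"
    using det_non_zero_imp_unit[OF P] by (auto simp: Units_def ring_mat_def)
  have "cmat A = cmat A * (P * Q)" using PQ cA by simp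
  also have "\<dots> = 1\<^sub>m m" using assoc_mult_mat[OF cA P(1) Q] AP' PQ by simp
  finally have e: "cmat A = 1\<^sub>m m" .
  show "A = 1\<^sub>m m"
  proof (rule eq_matI)
    fix i j assume "i < dim_row (1\<^sub>m m :: real mat)" "j < dim_col (1\<^sub>m m :: real mat)"
    then show "A $$ (i, j) = 1\<^sub>m m $$ (i, j)"
      using arg_cong[OF e, of "\<lambda>B. B $$ (i, j)"] Ac by (auto split: if_splits)
  qed (use Ac in auto)
qed

section \<open>The matrices of a periodic Jacobi operator and the trace of their squares\<close>

lemma sum_block_index:
  fixes f :: "nat \<Rightarrow> 'a :: comm_monoid_add"
  shows "(\<Sum>i<p * m. f i) = (\<Sum>r<p. \<Sum>k<m. f (r * m + k))"
proof -
  have "(\<Sum>i<p * m. f i) = (\<Sum>r<p. sum f {r * m..<r * m + m})"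
    by (rule sum.nat_group[symmetric])
  also have "\<dots> = (\<Sum>r<p. \<Sum>k<m. f (r * m + k))"
  proof (rule sum.cong[OF refl])
    fix r
    show "sum f {r * m..<r * m + m} = (\<Sum>k<m. f (r * m + k))"
      using sum.atLeastLessThan_shift_0[of f "r * m" "r * m + m"] by (simp add: lessThan_atLeast0)
  qed
  finally show ?thesis .
qed

lemma prod_atLeast1_eq_prod_list:
  "(\<Prod>n = 1..d. f n) = prod_list (map f [1..<Suc d])"
  using prod.distinct_set_conv_list[of "[1..<Suc d]" f]
  by (simp only: distinct_upt set_upt atLeastLessThanSuc_atLeastAtMost)

lemma sum_atLeast1_eq_sum_list:
  "(\<Sum>n = 1..d. f n) = sum_list (map f [1..<Suc d])"
  using sum.distinct_set_conv_list[of "[1..<Suc d]" f]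
  by (simp only: distinct_upt set_upt atLeastLessThanSuc_atLeastAtMost)

lemma eigenvalue_numbering_nth:
  assumes "char_poly A = (\<Prod>e\<leftarrow>es. [:- e, 1:])" "length es = dim_row A"
  shows "eigenvalue_numbering A (\<lambda>n. es ! (n - 1))"
proof -
  have "map (\<lambda>n. es ! (n - 1)) [1..<Suc (length es)] = map (nth es) [0..<length es]"
    unfolding One_nat_def map_Suc_upt[symmetric] by (simp add: o_def del: upt_Suc)
  then have "map (\<lambda>e. [:- e, 1:]) (map (\<lambda>n. es ! (n - 1)) [1..<Suc (length es)]) = map (\<lambda>e. [:- e, 1:]) es"
    by (simp only: map_nth)
  then show ?thesis
    unfolding eigenvalue_numbering_def prod_atLeast1_eq_prod_list assms(1) assms(2)[symmetric]
    by (simp only: map_map o_def)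
qed

lemma inverse_eq_cnj: "cmod \<tau> = 1 \<Longrightarrow> inverse \<tau> = cnj \<tau>"
  by (rule inverse_unique) (simp add: complex_norm_square[symmetric])

lemma upto_int_eq_map_upt: "[1..int p] = map int [1..<Suc p]"
  by (induction p) (simp_all add: upto_rec2)

lemma periodic_int_multiple:
  fixes f :: "int \<Rightarrow> 'a"
  assumes "\<And>n. f (n + q) = f n"
  shows "f (n + q * k) = f n"
proof (induction k rule: int_induct[of _ 0])
  case (step1 i)
  then show ?case using assms[of "n + q * i"] by (simp add: algebra_simps)
next
  case (step2 i)
  then show ?case using assms[of "n + q * (i - 1)"] by (simp add: algebra_simps)
qed simp

lemma periodic_representative:
  fixes f :: "int \<Rightarrow> 'a"
  assumes "\<And>n. f (n + int p) = f n" "p > 0"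
  obtains r where "r \<in> {1..p}" "f n = f (int r)"
proof -
  define r where "r = nat ((n - 1) mod int p) + 1"
  have ir: "int r = (n - 1) mod int p + 1" using assms(2) by (simp add: r_def)
  have "int r \<ge> 1" "int r \<le> int p"
    unfolding ir using assms(2) by (auto simp: add1_zle_eq)
  then have "r \<in> {1..p}" by auto
  moreover have "n = int r + int p * ((n - 1) div int p)" unfolding ir by simp
  then have "f n = f (int r)" using periodic_int_multiple[of f "int p", OF assms(1)] by metis
  ultimately show ?thesis using that by blast
qed

lemma det_foldr_mult:
  assumes "\<And>n. a n \<in> carrier_mat m m"
  shows "foldr (\<lambda>n P. a n * P) ns (1\<^sub>m m) \<in> carrier_mat m m \<and>
    det (foldr (\<lambda>n P. a n * P) ns (1\<^sub>m m)) = (\<Prod>n\<leftarrow>ns. det (a n))"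
  by (induction ns) (auto simp: det_mult[OF assms] intro: mult_carrier_mat[OF assms])

locale periodic_jacobi =
  fixes m p :: nat and a b :: "int \<Rightarrow> real mat"
  assumes m_pos: "m \<ge> 1" and p_ge: "p \<ge> 3"
    and a_pos: "\<And>n. positive_definite m (a n)"
    and b_self_adjoint: "\<And>n. self_adjoint m (b n)"
    and a_periodic: "\<And>n. a (n + int p) = a n"
    and b_periodic: "\<And>n. b (n + int p) = b n"
begin

abbreviation K :: "complex \<Rightarrow> complex mat" where "K \<equiv> K_mat m p a b"

lemma a_carrier: "a n \<in> carrier_mat m m" and b_carrier: "b n \<in> carrier_mat m m"
  using a_pos[of n] b_self_adjoint[of n] by (auto simp: positive_definite_def self_adjoint_def)

lemma dim_ab [simp]:
  "dim_row (a n) = m" "dim_col (a n) = m" "dim_row (b n) = m" "dim_col (b n) = m"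
  using a_carrier[of n] b_carrier[of n] by auto

lemma a_sym: "k < m \<Longrightarrow> l < m \<Longrightarrow> a n $$ (l, k) = a n $$ (k, l)"
  and b_sym: "k < m \<Longrightarrow> l < m \<Longrightarrow> b n $$ (l, k) = b n $$ (k, l)"
  using a_pos[of n] b_self_adjoint[of n] transpose_eqD[of "a n" m] transpose_eqD[of "b n" m]
  by (auto simp: positive_definite_def self_adjoint_def)

lemma K_carrier: "K \<tau> \<in> carrier_mat (p * m) (p * m)"
  by (simp add: K_mat_def)

lemma K_block_entry:
  assumes "k < m" "l < m"
  shows "K_block m p a b \<tau> r s $$ (k, l) =
    (if r = s then complex_of_real (b (int r) $$ (k, l))
     else if s = r + 1 then complex_of_real (a (int r) $$ (k, l))
     else if r = s + 1 then complex_of_real (a (int s) $$ (k, l))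
     else if r = 1 \<and> s = p then inverse \<tau> * complex_of_real (a (int p) $$ (k, l))
     else if r = p \<and> s = 1 then \<tau> * complex_of_real (a (int p) $$ (k, l))
     else 0)"
  using assms by (simp add: K_block_def)

lemma K_block_transpose:
  assumes "k < m" "l < m"
  shows "K_block m p a b (inverse \<tau>) s r $$ (l, k) = K_block m p a b \<tau> r s $$ (k, l)"
  unfolding K_block_entry[OF assms] K_block_entry[OF assms(2,1)]
  using p_ge by (auto simp: a_sym[OF assms] b_sym[OF assms])

lemma index_div_mod:
  assumes "i < p * m"
  shows "i div m < p" "i mod m < m"
  using assms m_pos by (auto simp: less_mult_imp_div_less)

lemma K_entry:
  assumes "r < p" "s < p" "k < m" "l < m"
  shows "K \<tau> $$ (r * m + k, s * m + l) = K_block m p a b \<tau> (Suc r) (Suc s) $$ (k, l)"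
  using assms block_index_less[of r p k m] block_index_less[of s p l m] by (simp add: K_mat_def)

lemma K_transpose: "transpose_mat (K \<tau>) = K (inverse \<tau>)"
  by (rule eq_matI) (auto simp: K_mat_def index_div_mod K_block_transpose)

lemma K_hermitian:
  assumes "cmod \<tau> = 1"
  shows "hermitian (p * m) (K \<tau>)"
  unfolding hermitian_def
proof (intro conjI allI impI)
  have inv: "inverse (cnj \<tau>) = \<tau>"
    using inverse_eq_cnj[of "cnj \<tau>"] assms by simp
  fix i j assume ij: "i < p * m" "j < p * m"
  have "K \<tau> $$ (j, i) = K (inverse \<tau>) $$ (i, j)"
    using ij K_carrier[of \<tau>] by (subst K_transpose[symmetric]) simp
  also have "\<dots> = cnj (K \<tau> $$ (i, j))"
    using ij by (simp add: K_mat_def K_block_entry index_div_mod inverse_eq_cnj[OF assms] inv)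
  finally show "K \<tau> $$ (j, i) = cnj (K \<tau> $$ (i, j))" .
qed (rule K_carrier)

text \<open>The trace of $K_p(\tau)^2$, for any unimodular $\tau$; its independence of $\tau$ is what allows a
  single $\tau$ to determine the operator.\<close>

definition trace_sq :: real where
  "trace_sq = (\<Sum>n = 1..p. frobenius_sq m (b (int n)) + 2 * frobenius_sq m (a (int n)))"

text \<open>Block $(r,s)$ is $b_r$ on the diagonal, $a_r$ where $s$ is the cyclic successor of $r$, and $a_s$ where
  $r$ is the cyclic successor of $s$; the corners differ from this only by the unimodular factors
  $\tau^{\pm 1}$. For $p \ge 3$ these three positions are distinct.\<close>

lemma block_square_sum:
  fixes r s :: nat
  assumes "cmod \<tau> = 1" "r \<in> {1..p}" "s \<in> {1..p}"
  defines "succ \<equiv> \<lambda>r. if r = p then 1 else r + 1"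
  shows "(\<Sum>k<m. \<Sum>l<m. (cmod (K_block m p a b \<tau> r s $$ (k, l)))\<^sup>2) =
    (if s = r then frobenius_sq m (b (int r)) else 0)
    + (if s = succ r then frobenius_sq m (a (int r)) else 0)
    + (if r = succ s then frobenius_sq m (a (int s)) else 0)"
proof -
  have "(\<Sum>k<m. \<Sum>l<m. (cmod (K_block m p a b \<tau> r s $$ (k, l)))\<^sup>2) =
    (\<Sum>k<m. \<Sum>l<m. (if s = r then (b (int r) $$ (k, l))\<^sup>2 else 0)
    + (if s = succ r then (a (int r) $$ (k, l))\<^sup>2 else 0)
    + (if r = succ s then (a (int s) $$ (k, l))\<^sup>2 else 0))"
    using assms p_ge
    by (intro sum.cong refl) (auto simp: K_block_entry norm_mult norm_inverse succ_def)
  also have "\<dots> = (if s = r then frobenius_sq m (b (int r)) else 0)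
    + (if s = succ r then frobenius_sq m (a (int r)) else 0)
    + (if r = succ s then frobenius_sq m (a (int s)) else 0)"
    by (simp add: sum.distrib frobenius_sq_def)
  finally show ?thesis .
qed

lemma K_square_sum:
  assumes "cmod \<tau> = 1"
  shows "(\<Sum>i<p * m. \<Sum>j<p * m. K \<tau> $$ (i, j) * K \<tau> $$ (j, i)) = complex_of_real trace_sq"
proof -
  define succ where "succ = (\<lambda>r. if r = p then 1 else r + 1)"
  have succ: "succ r \<in> {1..p}" if "r \<in> {1..p}" for r using that p_ge by (auto simp: succ_def)
  have "(\<Sum>i<p * m. \<Sum>j<p * m. (cmod (K \<tau> $$ (i, j)))\<^sup>2)
      = (\<Sum>r<p. \<Sum>k<m. \<Sum>s<p. \<Sum>l<m. (cmod (K \<tau> $$ (r * m + k, s * m + l)))\<^sup>2)"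
    by (simp add: sum_block_index)
  also have "\<dots> = (\<Sum>r<p. \<Sum>s<p. \<Sum>k<m. \<Sum>l<m. (cmod (K_block m p a b \<tau> (Suc r) (Suc s) $$ (k, l)))\<^sup>2)"
    by (rule sum.cong[OF refl], subst sum.swap, intro sum.cong refl) (simp add: K_entry)
  also have "\<dots> = (\<Sum>r = 1..p. \<Sum>s = 1..p. \<Sum>k<m. \<Sum>l<m. (cmod (K_block m p a b \<tau> r s $$ (k, l)))\<^sup>2)"
    by (simp add: sum.atLeast1_atMost_eq)
  also have "\<dots> = (\<Sum>r = 1..p. \<Sum>s = 1..p. (if s = r then frobenius_sq m (b (int r)) else 0)
      + (if s = succ r then frobenius_sq m (a (int r)) else 0)
      + (if r = succ s then frobenius_sq m (a (int s)) else 0))"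
    unfolding succ_def by (intro sum.cong refl block_square_sum assms)
  also have "\<dots> = (\<Sum>r = 1..p. \<Sum>s = 1..p. if s = r then frobenius_sq m (b (int r)) else 0)
      + (\<Sum>r = 1..p. \<Sum>s = 1..p. if s = succ r then frobenius_sq m (a (int r)) else 0)
      + (\<Sum>s = 1..p. \<Sum>r = 1..p. if r = succ s then frobenius_sq m (a (int s)) else 0)"
    unfolding sum.distrib
    by (subst sum.swap[of "\<lambda>r s. if r = succ s then frobenius_sq m (a (int s)) else 0"]) simp
  also have "\<dots> = (\<Sum>r = 1..p. frobenius_sq m (b (int r)))
      + (\<Sum>r = 1..p. frobenius_sq m (a (int r))) + (\<Sum>r = 1..p. frobenius_sq m (a (int r)))"
    using succ by (intro arg_cong2[of _ _ _ _ "(+)"] sum.cong refl) simp_all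
  also have "\<dots> = trace_sq"
    by (simp add: trace_sq_def sum.distrib sum_distrib_left[symmetric])
  finally have e: "(\<Sum>i<p * m. \<Sum>j<p * m. (cmod (K \<tau> $$ (i, j)))\<^sup>2) = trace_sq" .
  have "(\<Sum>i<p * m. \<Sum>j<p * m. K \<tau> $$ (i, j) * K \<tau> $$ (j, i))
      = (\<Sum>i<p * m. \<Sum>j<p * m. complex_of_real ((cmod (K \<tau> $$ (i, j)))\<^sup>2))"
  proof (intro sum.cong refl)
    fix i j assume "i \<in> {..<p * m}" "j \<in> {..<p * m}"
    then have "K \<tau> $$ (j, i) = cnj (K \<tau> $$ (i, j))"
      using K_hermitian[OF assms] unfolding hermitian_def by blast
    then show "K \<tau> $$ (i, j) * K \<tau> $$ (j, i) = complex_of_real ((cmod (K \<tau> $$ (i, j)))\<^sup>2)"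
      by (simp only: complex_norm_square)
  qed
  then show ?thesis unfolding e[symmetric] by simp
qed

lemma eigenvalue_square_sum:
  assumes "cmod \<tau> = 1" "eigenvalue_numbering (K \<tau>) lam"
  shows "(\<Sum>n = 1..m * p. (lam n)\<^sup>2) = complex_of_real trace_sq"
proof -
  have "char_poly (K \<tau>) = (\<Prod>e\<leftarrow>map lam [1..<Suc (p * m)]. [:- e, 1:])"
    using assms(2) K_carrier[of \<tau>]
    unfolding eigenvalue_numbering_def prod_atLeast1_eq_prod_list by (simp add: o_def)
  from sum_list_eigenvalue_squares[OF K_carrier this] show ?thesis
    unfolding K_square_sum[OF assms(1)] sum_atLeast1_eq_sum_list by (simp add: o_def mult.commute)
qed

lemma ex_eigenvalue_numbering: "\<exists>lam. eigenvalue_numbering (K \<tau>) lam"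
proof -
  obtain es where es: "char_poly (K \<tau>) = (\<Prod>e\<leftarrow>es. [:- e, 1:])" "length es = p * m"
    using char_poly_factorized[OF K_carrier] by blast
  have "eigenvalue_numbering (K \<tau>) (\<lambda>n. es ! (n - 1))"
    by (rule eigenvalue_numbering_nth[OF es(1)]) (use es(2) K_carrier[of \<tau>] in simp)
  then show ?thesis by blast
qed

lemma det_period_product: "det (period_product m p a) = (\<Prod>n = 1..p. det (a (int n)))"
proof -
  have "det (period_product m p a) = (\<Prod>n\<leftarrow>map int [1..<Suc p]. det (a n))"
    unfolding period_product_def upto_int_eq_map_upt using det_foldr_mult[of a, OF a_carrier] by blast
  then show ?thesis unfolding prod_atLeast1_eq_prod_list by (simp add: o_def)
qed

text \<open>The gaps in the logarithmic inequalities and the norms of the $b_n$ are nonnegative. Since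
  $\sum_n \ln\det a_n = \ln c = 0$, they add up to the excess of the trace over $2pm$.\<close>

lemma free_if_trace_sq_minimal:
  assumes c: "det (period_product m p a) = 1" and E: "trace_sq = 2 * real p * real m"
  shows "a n = 1\<^sub>m m \<and> b n = 0\<^sub>m m m"
proof -
  define gap where "gap = (\<lambda>n. frobenius_sq m (b (int n))
    + 2 * (frobenius_sq m (a (int n)) - (real m + 2 * ln (det (a (int n))))))"
  have gap: "gap n \<ge> 0" for n
    using frobenius_sq_nonneg[of m "b (int n)"] log_det_inequality(2)[OF a_pos, of "int n"]
    by (simp add: gap_def)
  have "(\<Sum>n = 1..p. ln (det (a (int n)))) = ln (\<Prod>n = 1..p. det (a (int n)))"
    using log_det_inequality(1)[OF a_pos, THEN less_imp_neq] by (intro ln_prod[symmetric]) auto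
  also have "\<dots> = 0" using c unfolding det_period_product by simp
  finally have l: "(\<Sum>n = 1..p. ln (det (a (int n)))) = 0" .
  have "(\<Sum>n = 1..p. gap n) = trace_sq - 2 * real p * real m - 4 * (\<Sum>n = 1..p. ln (det (a (int n))))"
    by (simp add: gap_def trace_sq_def sum.distrib sum_subtractf sum_distrib_left algebra_simps)
  then have "(\<Sum>n = 1..p. gap n) = 0" using E l by simp
  then have g0: "gap n = 0" if "n \<in> {1..p}" for n
    using gap that by (subst (asm) sum_nonneg_eq_0_iff) auto
  have ab: "a (int n) = 1\<^sub>m m" "b (int n) = 0\<^sub>m m m" if "n \<in> {1..p}" for n
  proof -
    have "frobenius_sq m (b (int n)) = 0"
      "frobenius_sq m (a (int n)) = real m + 2 * ln (det (a (int n)))"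
      using g0[OF that] frobenius_sq_nonneg[of m "b (int n)"] log_det_inequality(2)[OF a_pos, of "int n"]
      by (auto simp: gap_def)
    then show "a (int n) = 1\<^sub>m m" "b (int n) = 0\<^sub>m m m"
      using log_det_inequality(3)[OF a_pos] frobenius_sq_eq_0[OF b_carrier] by auto
  qed
  have p0: "p > 0" using p_ge by simp
  obtain r where "r \<in> {1..p}" "a n = a (int r)"
    by (rule periodic_representative[of a p n, OF a_periodic p0])
  then have "a n = 1\<^sub>m m" using ab(1) by simp
  moreover obtain s where "s \<in> {1..p}" "b n = b (int s)"
    by (rule periodic_representative[of b p n, OF b_periodic p0])
  then have "b n = 0\<^sub>m m m" using ab(2) by simp
  ultimately show ?thesis by simp
qed

end

abbreviation K_free :: "nat \<Rightarrow> nat \<Rightarrow> complex \<Rightarrow> complex mat" where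
  "K_free m p \<equiv> K_mat m p (\<lambda>_. 1\<^sub>m m) (\<lambda>_. 0\<^sub>m m m)"

lemma periodic_jacobi_free:
  assumes "m \<ge> 1" "p \<ge> 3"
  shows "periodic_jacobi m p (\<lambda>_. 1\<^sub>m m) (\<lambda>_. 0\<^sub>m m m)"
proof (unfold_locales, goal_cases)
  case (3 n)
  have "v \<bullet> v > 0" if "v \<in> carrier_vec m" "v \<noteq> 0\<^sub>v m" for v :: "real vec"
  proof -
    have "\<exists>i<m. v $ i \<noteq> 0"
    proof (rule ccontr)
      assume "\<not> (\<exists>i<m. v $ i \<noteq> 0)"
      then have "v = 0\<^sub>v m" using that(1) by (intro eq_vecI) auto
      then show False using that(2) by simp
    qed
    then obtain i where i: "i < m" "v $ i \<noteq> 0" by blast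
    have "0 < (\<Sum>i<m. v $ i * v $ i)"
      using i by (intro sum_pos2[of _ i]) (auto simp: zero_less_mult_iff linorder_neq_iff)
    then show ?thesis using that by (simp add: scalar_prod_def lessThan_atLeast0)
  qed
  then show ?case by (auto simp: positive_definite_def)
next
  case (4 n)
  then show ?case by (auto simp: self_adjoint_def)
qed (use assms in auto)

lemma trace_sq_free:
  assumes "m \<ge> 1" "p \<ge> 3"
  shows "periodic_jacobi.trace_sq m p (\<lambda>_. 1\<^sub>m m) (\<lambda>_. 0\<^sub>m m m) = 2 * real p * real m"
proof -
  have "frobenius_sq m (0\<^sub>m m m) = 0" by (simp add: frobenius_sq_def)
  moreover have "frobenius_sq m (1\<^sub>m m) = (\<Sum>i<m. \<Sum>j<m. if j = i then 1 else 0)"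
    unfolding frobenius_sq_def by (intro sum.cong refl) auto
  then have "frobenius_sq m (1\<^sub>m m) = real m" by simp
  ultimately show ?thesis
    unfolding periodic_jacobi.trace_sq_def[OF periodic_jacobi_free[OF assms]] by simp
qed

section \<open>Spectrum of the free matrices\<close>

text \<open>The $p$-th roots of $e^{i\kappa}$: the sequence $z^n$ is an eigenfunction of the scalar free Jacobi
  operator with quasi-period factor $e^{i\kappa}$ and eigenvalue $z + z^{-1}$.\<close>

definition free_root :: "nat \<Rightarrow> real \<Rightarrow> nat \<Rightarrow> complex" where
  "free_root p \<kappa> j = cis ((\<kappa> + 2 * pi * real j) / real p)"

lemma free_root_nonzero: "free_root p \<kappa> j \<noteq> 0"
  by (simp add: free_root_def)

lemma free_root_power:
  assumes "p > 0"
  shows "free_root p \<kappa> j ^ p = cis \<kappa>"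
proof -
  have "real j \<in> \<int>" by simp
  then have "cis (2 * pi * real j) = 1" by (rule cis_multiple_2pi)
  then have "cis (\<kappa> + 2 * pi * real j) = cis \<kappa>" by (simp add: cis_mult[symmetric])
  then show ?thesis using assms by (simp add: free_root_def DeMoivre)
qed

lemma free_root_plus_inverse:
  "free_root p \<kappa> j + inverse (free_root p \<kappa> j) = complex_of_real (2 * cos ((\<kappa> + 2 * pi * real j) / real p))"
  by (simp add: free_root_def complex_eq_iff)

lemma free_root_mod_inj:
  assumes "j div p = j' div p" "free_root p \<kappa> j = free_root p \<kappa> j'" "p > 0"
  shows "j = j'"
proof -
  obtain n :: int where n: "(\<kappa> + 2 * pi * real j) / real p = (\<kappa> + 2 * pi * real j') / real p + 2 * pi * n"
    using assms(2) sin_cos_eq_iff by (auto simp: free_root_def complex_eq_iff)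
  then have "2 * pi * real j = 2 * pi * (real j' + real p * real_of_int n)"
    using assms(3) by (simp add: field_simps)
  then have "real j = real j' + real p * real_of_int n" by simp
  then have "real_of_int (int j) = real_of_int (int j' + int p * n)" by simp
  then have "int j = int j' + int p * n" by (simp only: of_int_eq_iff)
  then have "int (j mod p) = int (j' mod p)" by (simp add: zmod_int)
  then have "j mod p = j' mod p" by simp
  then show ?thesis using assms(1) by (metis div_mult_mod_eq)
qed

lemma geometric_sum_free_roots:
  assumes "p > 0" "j div p = j' div p"
  shows "(\<Sum>r<p. inverse (free_root p \<kappa> j) ^ r * free_root p \<kappa> j' ^ r) = (if j = j' then of_nat p else 0)"
proof -
  define w where "w = inverse (free_root p \<kappa> j) * free_root p \<kappa> j'"
  have "w ^ p = 1"
    using assms(1) by (simp add: w_def power_mult_distrib power_inverse free_root_power cis_mult)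
  moreover have "w \<noteq> 1" if "j \<noteq> j'"
  proof
    assume "w = 1"
    then have "free_root p \<kappa> j = free_root p \<kappa> j'"
      using free_root_nonzero[of p \<kappa> j] by (simp add: w_def field_simps)
    then show False using free_root_mod_inj[OF assms(2) _ assms(1)] that by blast
  qed
  moreover have "w = 1" if "j = j'" using free_root_nonzero[of p \<kappa> j] that by (simp add: w_def)
  ultimately have "(\<Sum>r<p. w ^ r) = (if j = j' then of_nat p else 0)"
    by (auto simp: geometric_sum)
  then show ?thesis by (simp add: w_def power_mult_distrib)
qed

text \<open>The columns of \<open>V\<close> are the Fourier modes $n \mapsto z^n e_q$, one for each root $z$ and each
  coordinate $q < m$. Column $j$ carries the root number $j$ and the coordinate \<open>j div p\<close>, so the
  eigenvalues appear along the diagonal in the order of the formula $2\cos((\kappa + 2\pi j)/p)$,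
  which repeats every $p$ indices. Orthogonality of the modes makes \<open>W\<close> the inverse of \<open>V\<close>.\<close>

lemma char_poly_K_free:
  assumes m: "m \<ge> 1" and p: "p \<ge> 3"
  shows "char_poly (K_free m p (cis \<kappa>)) =
    (\<Prod>j<p * m. [:- complex_of_real (2 * cos ((\<kappa> + 2 * pi * real j) / real p)), 1:])"
proof -
  interpret periodic_jacobi m p "\<lambda>_. 1\<^sub>m m" "\<lambda>_. 0\<^sub>m m m"
    by (rule periodic_jacobi_free[OF m p])
  define n where "n = p * m"
  define z where "z = free_root p \<kappa>"
  define ev where "ev = (\<lambda>j. complex_of_real (2 * cos ((\<kappa> + 2 * pi * real j) / real p)))"
  define V where "V = mat n n (\<lambda>(i, j). if i mod m = j div p then z j ^ (i div m) else 0)"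
  define W where "W = mat n n (\<lambda>(j, i). if i mod m = j div p then inverse (z j) ^ (i div m) / of_nat p else 0)"
  define D where "D = mat n n (\<lambda>(i, j). if i = j then ev i else 0)"
  have V: "V \<in> carrier_mat n n" and W: "W \<in> carrier_mat n n" and D: "D \<in> carrier_mat n n"
    by (simp_all add: V_def W_def D_def)
  have Kc: "K (cis \<kappa>) \<in> carrier_mat n n" unfolding n_def by (rule K_carrier)
  have p0: "p > 0" using p by simp
  have jp: "j div p < m" if "j < n" for j
    using that by (simp add: n_def less_mult_imp_div_less mult.commute)
  have V_block: "V $$ (r * m + k, j) = (if k = j div p then z j ^ r else 0)"
    if "r < p" "k < m" "j < n" for r k j
    using that block_index_less[OF that(1,2)] by (simp add: V_def n_def)
  have W_block: "W $$ (j, r * m + k) = (if k = j div p then inverse (z j) ^ r / of_nat p else 0)"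
    if "r < p" "k < m" "j < n" for r k j
    using that block_index_less[OF that(1,2)] by (simp add: W_def n_def)
  have WV: "W * V = 1\<^sub>m n"
  proof (rule eq_matI)
    fix j j' assume "j < dim_row (1\<^sub>m n :: complex mat)" "j' < dim_col (1\<^sub>m n :: complex mat)"
    then have jj: "j < n" "j' < n" by auto
    have "(W * V) $$ (j, j') = (\<Sum>r<p. \<Sum>k<m. W $$ (j, r * m + k) * V $$ (r * m + k, j'))"
      unfolding index_mult_mat_sum[OF W V jj] unfolding n_def by (rule sum_block_index)
    also have "\<dots> = (\<Sum>r<p. \<Sum>k<m. if k = j div p then
        (if j div p = j' div p then inverse (z j) ^ r * z j' ^ r / of_nat p else 0) else 0)"
      using jj by (intro sum.cong refl) (auto simp: V_block W_block)
    also have "\<dots> = (if j div p = j' div p then (\<Sum>r<p. inverse (z j) ^ r * z j' ^ r) / of_nat p else 0)"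
      using jp[OF jj(1)] by (simp add: sum_divide_distrib)
    also have "\<dots> = (if j = j' then 1 else 0)"
      using geometric_sum_free_roots[OF p0, of j j' \<kappa>] p0 by (auto simp: z_def)
    finally show "(W * V) $$ (j, j') = 1\<^sub>m n $$ (j, j')" using jj by simp
  qed (use V W in auto)
  have VW: "V * W = 1\<^sub>m n" by (rule mat_mult_left_right_inverse[OF W V WV])
  define succ where "succ = (\<lambda>r. if r = p - 1 then 0 else r + 1)"
  define pred where "pred = (\<lambda>r. if r = 0 then p - 1 else r - 1)"
  \<comment> \<open>Going one block to the right or left, cyclically, multiplies the mode by $z$ or $1/z$; at the corners the factors $\tau^{\pm 1} = z^{\pm p}$ compensate the wrap-around.\<close>
  have K_block_free: "K_block m p (\<lambda>_. 1\<^sub>m m) (\<lambda>_. 0\<^sub>m m m) (cis \<kappa>) (Suc r) (Suc s) $$ (k, l) * z j ^ s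
      = (if k = l then z j ^ r * ((if s = succ r then z j else 0) + (if s = pred r then inverse (z j) else 0)) else 0)"
    if "r < p" "s < p" "k < m" "l < m" for r s k l j
  proof -
    have z0: "z j \<noteq> 0" unfolding z_def by (rule free_root_nonzero)
    have zp: "cis \<kappa> = z j ^ (p - 1) * z j"
      using free_root_power[OF p0, of \<kappa> j] p0 unfolding z_def
      by (metis Suc_pred' power_Suc2)
    have "inverse (cis \<kappa>) * z j ^ (p - 1) = inverse (z j)" unfolding zp using z0 by simp
    note zq = this
    have entry: "K_block m p (\<lambda>_. 1\<^sub>m m) (\<lambda>_. 0\<^sub>m m m) (cis \<kappa>) (Suc r) (Suc s) $$ (k, l) =
        (if k = l then (if r = s then 0 else if s = r + 1 then 1 else if r = s + 1 then 1
          else if r = 0 \<and> s = p - 1 then inverse (cis \<kappa>)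
          else if r = p - 1 \<and> s = 0 then cis \<kappa> else 0) else 0)"
      using that p unfolding K_block_entry[OF that(3,4)] by auto
    consider "s = r + 1" | "r = p - 1" "s = 0" | "r = s + 1" | "r = 0" "s = p - 1"
      | "r \<noteq> s + 1" "s \<noteq> r + 1" "\<not> (r = p - 1 \<and> s = 0)" "\<not> (r = 0 \<and> s = p - 1)"
      by blast
    then show ?thesis
    proof cases
      case 1
      then show ?thesis using that p unfolding entry succ_def pred_def by auto
    next
      case 2
      then show ?thesis using that p zp unfolding entry succ_def pred_def by auto
    next
      case 3
      then show ?thesis using that p z0 unfolding entry succ_def pred_def by auto
    next
      case 4
      then show ?thesis using that p zq unfolding entry succ_def pred_def by auto
    next
      case 5
      then show ?thesis using that p unfolding entry succ_def pred_def by auto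
    qed
  qed
  have KV: "K (cis \<kappa>) * V = V * D"
  proof (rule eq_matI)
    fix i j assume "i < dim_row (V * D)" "j < dim_col (V * D)"
    then have ij: "i < n" "j < n" using V D by auto
    define r where "r = i div m"
    define k where "k = i mod m"
    have i: "i = r * m + k" and r: "r < p" and k: "k < m"
      using index_div_mod[of i] ij by (auto simp: r_def k_def n_def)
    have q: "j div p < m" by (rule jp[OF ij(2)])
    have "(K (cis \<kappa>) * V) $$ (i, j) = (\<Sum>s<p. \<Sum>l<m. K (cis \<kappa>) $$ (i, s * m + l) * V $$ (s * m + l, j))"
      unfolding index_mult_mat_sum[OF Kc V ij] unfolding n_def by (rule sum_block_index)
    also have "\<dots> = (\<Sum>s<p. \<Sum>l<m. if l = j div p then
        K_block m p (\<lambda>_. 1\<^sub>m m) (\<lambda>_. 0\<^sub>m m m) (cis \<kappa>) (Suc r) (Suc s) $$ (k, j div p) * z j ^ s else 0)"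
      unfolding i using r k ij(2) by (intro sum.cong refl) (simp add: K_entry V_block)
    also have "\<dots> = (\<Sum>s<p. K_block m p (\<lambda>_. 1\<^sub>m m) (\<lambda>_. 0\<^sub>m m m) (cis \<kappa>) (Suc r) (Suc s) $$ (k, j div p) * z j ^ s)"
      using q by simp
    also have "\<dots> = (\<Sum>s<p. if k = j div p then
        z j ^ r * ((if s = succ r then z j else 0) + (if s = pred r then inverse (z j) else 0)) else 0)"
      by (intro sum.cong refl K_block_free r k q) simp
    also have "\<dots> = (if k = j div p then z j ^ r * (z j + inverse (z j)) else 0)"
    proof -
      have "succ r < p" "pred r < p" using r p by (auto simp: succ_def pred_def)
      then show ?thesis by (simp add: sum_distrib_left[symmetric] sum.distrib)
    qed
    also have "\<dots> = V $$ (i, j) * ev j"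
      unfolding i V_block[OF r k ij(2)] ev_def z_def free_root_plus_inverse by simp
    also have "\<dots> = (\<Sum>t<n. if t = j then V $$ (i, j) * ev j else 0)" using ij by simp
    also have "\<dots> = (\<Sum>t<n. V $$ (i, t) * D $$ (t, j))"
      using ij by (intro sum.cong refl) (auto simp: D_def)
    also have "\<dots> = (V * D) $$ (i, j)" by (rule index_mult_mat_sum[OF V D ij, symmetric])
    finally show "(K (cis \<kappa>) * V) $$ (i, j) = (V * D) $$ (i, j)" .
  qed (use Kc V D in auto)
  have "K (cis \<kappa>) = K (cis \<kappa>) * (V * W)" using VW Kc by simp
  also have "\<dots> = V * D * W" using assoc_mult_mat[OF Kc V W] KV by simp
  finally have "similar_mat (K (cis \<kappa>)) D"
    by (intro similar_matI[of _ _ V W n] VW WV) (use Kc V W D in auto)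
  then have "char_poly (K (cis \<kappa>)) = char_poly D" by (rule char_poly_similar)
  also have "\<dots> = (\<Prod>a\<leftarrow>diag_mat D. [:- a, 1:])"
    by (rule char_poly_upper_triangular[OF D]) (auto simp: D_def)
  also have "diag_mat D = map ev [0..<n]"
    unfolding diag_mat_def by (intro map_cong) (auto simp: D_def)
  also have "(\<Prod>a\<leftarrow>map ev [0..<n]. [:- a, 1:]) = (\<Prod>j<n. [:- ev j, 1:])"
    using prod.distinct_set_conv_list[of "[0..<n]" "\<lambda>j. [:- ev j, 1:]"]
    by (simp add: o_def lessThan_atLeast0)
  finally show ?thesis unfolding ev_def n_def .
qed

section \<open>The determinant as a polynomial in the Floquet multiplier\<close>

lemma det_scale_rows:
  fixes A :: "'a :: comm_ring_1 mat"
  assumes A: "A \<in> carrier_mat n n"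
  shows "det (mat n n (\<lambda>(i, j). c i * A $$ (i, j))) = (\<Prod>i<n. c i) * det A"
proof -
  have carr: "mat n n (\<lambda>(i, j). c i * A $$ (i, j)) \<in> carrier_mat n n" by simp
  have "det (mat n n (\<lambda>(i, j). c i * A $$ (i, j))) =
      (\<Sum>q\<in>{q. q permutes {0..<n}}. signof q * (\<Prod>i = 0..<n. c i * A $$ (i, q i)))"
    unfolding det_def'[OF carr]
    by (intro sum.cong refl arg_cong2[of _ _ _ _ "(*)"] prod.cong) (auto dest: permutes_in_image)
  then show ?thesis
    unfolding det_def'[OF A] sum_distrib_left
    by (simp add: prod.distrib lessThan_atLeast0 algebra_simps)
qed

lemma linear_powers_mult_dvd:
  fixes u v :: "'a :: idom"
  assumes "u \<noteq> v" and h: "h \<noteq> 0" and du: "[:- u, 1:] ^ k dvd h" and dv: "[:- v, 1:] ^ l dvd h"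
  shows "[:- u, 1:] ^ k * [:- v, 1:] ^ l dvd h"
proof -
  obtain g where g: "h = [:- u, 1:] ^ k * g" using du by (elim dvdE)
  have "Polynomial.order v h = Polynomial.order v ([:- u, 1:] ^ k) + Polynomial.order v g"
    using h unfolding g by (rule order_mult)
  moreover have "Polynomial.order v ([:- u, 1:] ^ k) = 0"
    using assms(1) by (intro order_0I) simp
  moreover have "l \<le> Polynomial.order v h" using dv h by (simp add: order_divides)
  ultimately have "[:- v, 1:] ^ l dvd g" by (simp add: order_divides)
  then show ?thesis unfolding g by (rule mult_dvd_mono[OF dvd_refl])
qed

context periodic_jacobi
begin

text \<open>A polynomial version of $\mu - K_p(1/\epsilon)$, in the variable $\epsilon$: only the corner blocks depend on
  $\epsilon$, and multiplying the last block row by $\epsilon$ clears the denominator. That row is then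
  $\epsilon$ times a constant except for its first block, and in the first block row only the last
  block carries $\epsilon$. The constants are taken from \<open>K 1\<close>.\<close>

definition char_det_mat :: "complex \<Rightarrow> complex poly mat" where
  "char_det_mat \<mu> = mat (p * m) (p * m) (\<lambda>(i, j).
     if i div m = p - 1 \<and> j div m \<noteq> 0 \<or> i div m = 0 \<and> j div m = p - 1
     then [:0, (if i = j then \<mu> else 0) - K 1 $$ (i, j):]
     else [:(if i = j then \<mu> else 0) - K 1 $$ (i, j):])"

lemma char_det_mat_carrier: "char_det_mat \<mu> \<in> carrier_mat (p * m) (p * m)"
  by (simp add: char_det_mat_def)

lemma poly_char_det_mat:
  assumes "\<epsilon> \<noteq> 0" "i < p * m" "j < p * m"
  shows "poly (char_det_mat \<mu> $$ (i, j)) \<epsilon> =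
    (if i div m = p - 1 then \<epsilon> else 1) * ((if i = j then \<mu> else 0) - K (inverse \<epsilon>) $$ (i, j))"
proof -
  define r where "r = i div m"
  define s where "s = j div m"
  have rs: "r < p" "s < p" and kl: "i mod m < m" "j mod m < m"
    using index_div_mod[OF assms(2)] index_div_mod[OF assms(3)] by (auto simp: r_def s_def)
  have K: "K \<tau> $$ (i, j) = K_block m p a b \<tau> (Suc r) (Suc s) $$ (i mod m, j mod m)" for \<tau>
    using assms by (simp add: K_mat_def r_def s_def)
  have diag: "r = s" if "i = j" using that by (simp add: r_def s_def)
  have H: "char_det_mat \<mu> $$ (i, j) =
      (if r = p - 1 \<and> s \<noteq> 0 \<or> r = 0 \<and> s = p - 1
       then [:0, (if i = j then \<mu> else 0) - K 1 $$ (i, j):]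
       else [:(if i = j then \<mu> else 0) - K 1 $$ (i, j):])"
    using assms unfolding char_det_mat_def r_def s_def by simp
  consider "r = 0" "s = p - 1" | "r = p - 1" "s = 0" | "\<not> (r = 0 \<and> s = p - 1)" "\<not> (r = p - 1 \<and> s = 0)"
    by blast
  then show ?thesis
  proof cases
    case 1
    then have "i \<noteq> j" using diag p_ge by auto
    then show ?thesis
      using 1 p_ge unfolding H r_def[symmetric] K K_block_entry[OF kl] by simp
  next
    case 2
    then have "i \<noteq> j" using diag p_ge by auto
    then show ?thesis
      using 2 p_ge assms(1) unfolding H r_def[symmetric] K K_block_entry[OF kl] by simp
  next
    case 3
    then have "K (inverse \<epsilon>) $$ (i, j) = K 1 $$ (i, j)"
      using rs unfolding K K_block_entry[OF kl] by auto
    then show ?thesis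
      using 3 unfolding H r_def[symmetric] by auto
  qed
qed

text \<open>Clearing the denominator has multiplied $m$ rows by $\epsilon$, so on the unit circle the two
  determinants agree in modulus.\<close>

lemma norm_poly_det_char_det_mat:
  assumes "cmod \<epsilon> = 1"
  shows "cmod (poly (det (char_det_mat \<mu>)) \<epsilon>) = cmod (poly (char_poly (K (inverse \<epsilon>))) \<mu>)"
proof -
  define c where "c = (\<lambda>i. if i div m = p - 1 then \<epsilon> else 1)"
  define A where "A = mat (p * m) (p * m) (\<lambda>(i, j). (if i = j then \<mu> else 0) - K (inverse \<epsilon>) $$ (i, j))"
  have A: "A \<in> carrier_mat (p * m) (p * m)" by (simp add: A_def)
  have e0: "\<epsilon> \<noteq> 0" using assms by auto
  have "poly (det (char_det_mat \<mu>)) \<epsilon> = det (mat (p * m) (p * m) (\<lambda>(i, j). c i * A $$ (i, j)))"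
    by (rule poly_det_cong[of _ "p * m"])
      (auto simp: char_det_mat_carrier poly_char_det_mat[OF e0] c_def A_def)
  also have "\<dots> = (\<Prod>i<p * m. c i) * det A" by (rule det_scale_rows[OF A])
  also have "det A = poly (char_poly (K (inverse \<epsilon>))) \<mu>"
    unfolding char_poly_def
    by (rule poly_det_cong[symmetric, of _ "p * m"])
      (use K_carrier[of "inverse \<epsilon>"] in \<open>auto simp: A_def char_poly_matrix_def\<close>)
  finally show ?thesis
    using assms by (simp add: norm_mult c_def prod_norm[symmetric] if_distrib[of cmod] cong: if_cong)
qed

text \<open>Only the $2m$ rows of the first and the last block row involve $\epsilon$, each with degree one.\<close>

lemma degree_det_char_det_mat: "degree (det (char_det_mat \<mu>)) \<le> 2 * m"
proof -
  define d where "d = (\<lambda>i. if i div m = p - 1 \<or> i div m = 0 then 1 else 0 :: nat)"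
  have "degree (det (char_det_mat \<mu>)) \<le> (\<Sum>i<p * m. d i)"
    by (rule degree_det_le_sum[OF char_det_mat_carrier]) (auto simp: char_det_mat_def d_def)
  also have "\<dots> = (\<Sum>r<p. \<Sum>k<m. (if r = p - 1 then 1 else 0) + (if r = 0 then 1 else 0))"
    unfolding sum_block_index using p_ge by (intro sum.cong refl) (auto simp: d_def)
  also have "\<dots> = 2 * m" using p_ge by (simp add: sum.distrib sum_distrib_left[symmetric])
  finally show ?thesis .
qed

text \<open>At $\epsilon = 0$ the last block row is $(-a_p, 0, \dots, 0)$. Moved to the top, it makes the matrix block
  lower triangular with diagonal blocks $-a_p, -a_1, \dots, -a_{p-1}$.\<close>

lemma norm_poly_det_char_det_mat_0:
  "cmod (poly (det (char_det_mat \<mu>)) 0) = det (period_product m p a)"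
proof -
  define n where "n = (p - 1) * m"
  have pm: "p * m = m + n" using p_ge by (cases p) (simp_all add: n_def)
  define H0 where "H0 = mat (m + n) (m + n) (\<lambda>(i, j). poly (char_det_mat \<mu> $$ (i, j)) 0)"
  define L where "L = mat (m + n) (m + n) (\<lambda>(i, j). H0 $$ (if i < m then i + n else i - m, j))"
  have H0c: "H0 \<in> carrier_mat (m + n) (m + n)" by (simp add: H0_def)
  have H0: "H0 $$ (r * m + k, s * m + l) =
      (if r = p - 1 \<and> s \<noteq> 0 \<or> r = 0 \<and> s = p - 1 then 0
       else (if r * m + k = s * m + l then \<mu> else 0) - K 1 $$ (r * m + k, s * m + l))"
    if "r < p" "s < p" "k < m" "l < m" for r s k l
    using that block_index_less[of r p k m] block_index_less[of s p l m]
    by (simp add: H0_def char_det_mat_def pm[symmetric])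
  have idx0: "r * m + k = s * m + l \<longleftrightarrow> r = s \<and> k = l" if "k < m" "l < m" for r s k l
    using that by (metis add.commute div_mult_self3 div_less add_0 gr_implies_not0 add_left_cancel)
  have L0: "L $$ (k, s * m + l) = (if s = 0 then - complex_of_real (a (int p) $$ (k, l)) else 0)"
    if "s < p" "k < m" "l < m" for s k l
  proof -
    have "L $$ (k, s * m + l) = H0 $$ ((p - 1) * m + k, s * m + l)"
      using that block_index_less[of s p l m] by (simp add: L_def pm add.commute) (simp add: n_def)
    moreover have "H0 $$ ((p - 1) * m + k, s * m + l) =
        (if s \<noteq> 0 then 0 else - K_block m p a b 1 (Suc (p - 1)) (Suc s) $$ (k, l))"
      using that p_ge H0[of "p - 1" s k l] K_entry[of "p - 1" s k l 1] idx0[OF that(2,3), of "p - 1" s]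
      by auto
    ultimately show ?thesis
      using that p_ge by (simp add: K_block_entry)
  qed
  have LS: "L $$ (Suc r * m + k, s * m + l) =
      (if r = 0 \<and> s = p - 1 then 0
       else (if r = s \<and> k = l then \<mu> else 0) - K_block m p a b 1 (Suc r) (Suc s) $$ (k, l))"
    if "Suc r < p" "s < p" "k < m" "l < m" for r s k l
  proof -
    have "L $$ (Suc r * m + k, s * m + l) = H0 $$ (r * m + k, s * m + l)"
      using that block_index_less[of s p l m] block_index_less[of "Suc r" p k m]
      by (simp add: L_def pm)
    moreover have "r < p" "r \<noteq> p - 1" using that by auto
    ultimately show ?thesis
      using that H0[of r s k l] K_entry[of r s k l 1] idx0[OF that(3,4), of r s] by simp
  qed
  have "poly (det (char_det_mat \<mu>)) 0 = det H0"
    by (rule poly_det_cong[of _ "m + n"]) (use char_det_mat_carrier[of \<mu>] in \<open>auto simp: H0_def pm\<close>)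
  also have "\<dots> = (- 1) ^ (m * n) * det L"
    unfolding L_def by (rule det_swap_rows[OF H0c])
  finally have "cmod (poly (det (char_det_mat \<mu>)) 0) = cmod (det L)"
    by (simp add: norm_mult norm_power)
  also have "det L = (\<Prod>r<p. det (mat m m (\<lambda>(i, j). L $$ (r * m + i, r * m + j))))"
  proof (rule det_block_lower_triangular)
    show "L \<in> carrier_mat (p * m) (p * m)" by (simp add: L_def pm)
    fix i j assume ij: "i < p * m" "j < p * m" "i div m < j div m"
    define r where "r = i div m"
    define s where "s = j div m"
    define k where "k = i mod m"
    define l where "l = j mod m"
    have i: "i = r * m + k" and j: "j = s * m + l" and r: "r < p" and s: "s < p"
      and k: "k < m" and l: "l < m" and rs: "r < s"
      using index_div_mod[OF ij(1)] index_div_mod[OF ij(2)] ij(3)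
      by (auto simp: r_def s_def k_def l_def)
    show "L $$ (i, j) = 0"
    proof (cases r)
      case 0
      then show ?thesis unfolding i j using L0[OF s k l] rs by simp
    next
      case (Suc r')
      then show ?thesis unfolding i j using LS[of r' s k l] r s k l rs
        by (auto simp: K_block_entry)
    qed
  qed
  also have "\<dots> = (\<Prod>r<p. (- 1) ^ m * complex_of_real (det (a (int (if r = 0 then p else r)))))"
  proof (rule prod.cong[OF refl])
    fix r assume "r \<in> {..<p}"
    then have r: "r < p" by simp
    have "mat m m (\<lambda>(i, j). L $$ (r * m + i, r * m + j)) = (- 1) \<cdot>\<^sub>m cmat (a (int (if r = 0 then p else r)))"
    proof (rule eq_matI)
      fix k l assume "k < dim_row ((- 1) \<cdot>\<^sub>m cmat (a (int (if r = 0 then p else r))))"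
        "l < dim_col ((- 1) \<cdot>\<^sub>m cmat (a (int (if r = 0 then p else r))))"
      then have kl: "k < m" "l < m" by auto
      show "mat m m (\<lambda>(i, j). L $$ (r * m + i, r * m + j)) $$ (k, l)
          = ((- 1) \<cdot>\<^sub>m cmat (a (int (if r = 0 then p else r)))) $$ (k, l)"
      proof (cases r)
        case 0
        then show ?thesis using L0[of 0 k l] kl p_ge by simp
      next
        case (Suc r')
        moreover have "p - Suc 0 \<noteq> Suc 0" using p_ge by simp
        ultimately show ?thesis using LS[of r' r k l] kl r p_ge by (auto simp: K_block_entry)
      qed
    qed auto
    then show "det (mat m m (\<lambda>(i, j). L $$ (r * m + i, r * m + j)))
        = (- 1) ^ m * complex_of_real (det (a (int (if r = 0 then p else r))))"
      by simp
  qed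
  also have "cmod \<dots> = (\<Prod>r<p. det (a (int (if r = 0 then p else r))))"
    using log_det_inequality(1)[OF a_pos]
    by (simp add: prod_norm[symmetric] norm_mult norm_power abs_of_pos)
  also have "\<dots> = (\<Prod>n = 1..p. det (a (int n)))"
  proof -
    obtain q where q: "p = Suc q" using p_ge by (cases p) auto
    show ?thesis
      unfolding q by (subst prod.lessThan_Suc_shift) (simp add: prod.atLeast1_atMost_eq mult.commute)
  qed
  finally show ?thesis unfolding det_period_product .
qed

lemma root_multiplicity_char_det_mat:
  assumes "cmod \<epsilon> = 1" "[:- complex_of_real \<mu>, 1:] ^ N dvd char_poly (K (inverse \<epsilon>))"
  shows "[:- \<epsilon>, 1:] ^ N dvd det (char_det_mat (complex_of_real \<mu>))"
proof -
  have e0: "\<epsilon> \<noteq> 0" using assms by auto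
  have "cmod (inverse \<epsilon>) = 1" using assms by (simp add: norm_inverse)
  then obtain P where P: "P \<in> carrier_mat (p * m) (p * m)" "det P \<noteq> 0" "N \<le> p * m"
    and KP: "\<And>i j. i < p * m \<Longrightarrow> j < N \<Longrightarrow>
      (\<Sum>k<p * m. K (inverse \<epsilon>) $$ (i, k) * P $$ (k, j)) = complex_of_real \<mu> * P $$ (i, j)"
    by (rule hermitian_multiplicity_columns[OF K_hermitian assms(2)]) blast
  show ?thesis
  proof (rule det_root_multiplicity[OF char_det_mat_carrier P])
    fix i j assume ij: "i < p * m" "j < N"
    define c where "c = (if i div m = p - 1 then \<epsilon> else 1)"
    have "(\<Sum>k<p * m. poly (char_det_mat (complex_of_real \<mu>) $$ (i, k)) \<epsilon> * P $$ (k, j))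
        = (\<Sum>k<p * m. c * ((if k = i then complex_of_real \<mu> * P $$ (i, j) else 0)
            - K (inverse \<epsilon>) $$ (i, k) * P $$ (k, j)))"
      using ij by (intro sum.cong refl) (auto simp: poly_char_det_mat[OF e0] c_def algebra_simps)
    also have "\<dots> = c * (complex_of_real \<mu> * P $$ (i, j)
        - (\<Sum>k<p * m. K (inverse \<epsilon>) $$ (i, k) * P $$ (k, j)))"
      using ij by (simp add: sum_distrib_left[symmetric] sum_subtractf)
    also have "\<dots> = 0" using KP[OF ij] by simp
    finally show "(\<Sum>k<p * m. poly (char_det_mat (complex_of_real \<mu>) $$ (i, k)) \<epsilon> * P $$ (k, j)) = 0" .
  qed
qed

text \<open>The assumed multiplicity at $e^{i\kappa_0}$, and by transposition also at $e^{-i\kappa_0}$, accounts for all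
  $2m$ possible zeros of the determinant polynomial. For $e^{i\kappa_0} = \pm 1$ the two
  points coincide, which is why twice the multiplicity is demanded there.\<close>

theorem norm_char_poly_at_full_multiplicity:
  assumes mult: "[:- complex_of_real \<mu>, 1:] ^ (if cis (2 * \<kappa>0) = 1 then 2 * m else m) dvd char_poly (K (cis \<kappa>0))"
  shows "cmod (poly (char_poly (K (cis \<kappa>))) (complex_of_real \<mu>))
    = det (period_product m p a) * \<bar>2 * cos \<kappa> - 2 * cos \<kappa>0\<bar> ^ m"
proof -
  define h where "h = det (char_det_mat (complex_of_real \<mu>))"
  define N where "N = (if cis (2 * \<kappa>0) = 1 then 2 * m else m)"
  have c0: "det (period_product m p a) > 0"
    unfolding det_period_product by (intro prod_pos) (simp add: log_det_inequality(1)[OF a_pos])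
  have h0: "cmod (poly h 0) = det (period_product m p a)"
    unfolding h_def by (rule norm_poly_det_char_det_mat_0)
  have hn: "h \<noteq> 0" using h0 c0 by auto
  have inv: "inverse (cis \<kappa>0) = cis (- \<kappa>0)" by (rule inverse_eq_cnj[THEN trans]) (simp_all add: cis_cnj)
  have "char_poly (K (inverse (cis \<kappa>0))) = char_poly (K (cis \<kappa>0))"
    unfolding K_transpose[symmetric] by (rule char_poly_transpose_mat[OF K_carrier])
  then have d1: "[:- cis \<kappa>0, 1:] ^ N dvd h"
    unfolding h_def using mult by (intro root_multiplicity_char_det_mat) (simp_all add: N_def)
  have inv': "inverse (cis (- \<kappa>0)) = cis \<kappa>0" unfolding inv[symmetric] by simp
  have d2: "[:- cis (- \<kappa>0), 1:] ^ N dvd h"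
    unfolding h_def using mult by (intro root_multiplicity_char_det_mat) (simp_all add: N_def inv')
  define Q where "Q = [:- cis \<kappa>0, 1:] * [:- cis (- \<kappa>0), 1:]"
  have "Q ^ m dvd h"
  proof (cases "cis (2 * \<kappa>0) = 1")
    case True
    have "cis \<kappa>0 * cis \<kappa>0 = 1" using True by (simp add: cis_mult)
    then have "cis \<kappa>0 = cis (- \<kappa>0)" unfolding inv[symmetric] by (simp add: field_simps)
    then have "Q ^ m = [:- cis \<kappa>0, 1:] ^ N"
      using True by (simp add: Q_def N_def power_mult power2_eq_square)
    then show ?thesis using d1 by simp
  next
    case False
    have "cis \<kappa>0 \<noteq> cis (- \<kappa>0)"
    proof
      assume "cis \<kappa>0 = cis (- \<kappa>0)"
      then have "cis \<kappa>0 * cis \<kappa>0 = cis \<kappa>0 * cis (- \<kappa>0)" by simp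
      then show False using False by (simp add: cis_mult)
    qed
    then have "[:- cis \<kappa>0, 1:] ^ m * [:- cis (- \<kappa>0), 1:] ^ m dvd h"
      using d1 d2 False by (intro linear_powers_mult_dvd hn) (simp_all add: N_def)
    then show ?thesis unfolding Q_def power_mult_distrib .
  qed
  then obtain q where q: "h = Q ^ m * q" by (elim dvdE)
  have Q0: "Q \<noteq> 0" and dQ: "degree Q = 2" unfolding Q_def by (simp_all add: degree_mult_eq)
  have "degree h = 2 * m + degree q"
    using hn q Q0 dQ by (auto simp: degree_mult_eq degree_power_eq)
  moreover have "degree h \<le> 2 * m" unfolding h_def by (rule degree_det_char_det_mat)
  ultimately have "degree q = 0" by simp
  then obtain C where C: "q = [:C:]" by (rule degree_eq_zeroE)
  have "poly Q 0 = 1" by (simp add: Q_def cis_mult)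
  then have "cmod C = det (period_product m p a)" using h0 unfolding q C by simp
  moreover have "cmod (poly Q (cis (- \<kappa>))) = \<bar>2 * cos \<kappa> - 2 * cos \<kappa>0\<bar>"
  proof -
    have "poly Q (cis (- \<kappa>)) = cis (- \<kappa>) * complex_of_real (2 * cos \<kappa> - 2 * cos \<kappa>0)"
    proof -
      define x y u v where "x = cis (- \<kappa>)" "y = cis \<kappa>" "u = cis \<kappa>0" "v = cis (- \<kappa>0)"
      note xyuv = this
      have unit: "x * y = 1" "u * v = 1" by (simp_all add: xyuv cis_mult)
      have trace: "complex_of_real (2 * cos \<kappa> - 2 * cos \<kappa>0) = (x + y) - (u + v)"
        by (simp add: xyuv complex_eq_iff)
      have "poly Q x = (x - u) * (x - v)" by (simp add: Q_def xyuv algebra_simps)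
      then show ?thesis
        unfolding xyuv(1)[symmetric] trace using unit by (simp add: algebra_simps)
    qed
    then show ?thesis by (simp only: norm_mult norm_cis norm_of_real mult_1)
  qed
  ultimately have "cmod (poly h (cis (- \<kappa>))) = det (period_product m p a) * \<bar>2 * cos \<kappa> - 2 * cos \<kappa>0\<bar> ^ m"
    unfolding q C by (simp add: norm_mult norm_power mult.commute)
  moreover have "inverse (cis (- \<kappa>)) = cis \<kappa>"
    by (rule inverse_eq_cnj[THEN trans]) (simp_all add: cis_cnj)
  ultimately show ?thesis
    using norm_poly_det_char_det_mat[of "cis (- \<kappa>)" "complex_of_real \<mu>"] by (simp add: h_def)
qed

end

section \<open>Characterization of the free operator\<close>

lemma free_root_eq_mod:
  assumes "j mod p = j' mod p" "p > 0"
  shows "free_root p \<kappa> j = free_root p \<kappa> j'"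
proof -
  have "int j mod int p = int j' mod int p" using assms(1) by (simp add: zmod_int[symmetric])
  then obtain k where "int j = int j' + int p * k" by (auto simp: mod_eq_dvd_iff elim!: dvdE) (metis add.commute diff_add_cancel)
  then have "real_of_int (int j) = real_of_int (int j' + int p * k)" by simp
  then have "(\<kappa> + 2 * pi * real j) / real p = (\<kappa> + 2 * pi * real j') / real p + 2 * pi * real_of_int k"
    using assms(2) by (simp add: field_simps)
  then show ?thesis by (simp add: free_root_def cis_mult[symmetric])
qed

lemma card_residue_class:
  fixes c p m :: nat
  assumes "c < p"
  shows "card {j. j < p * m \<and> j mod p = c} = m"
proof -
  have "{j. j < p * m \<and> j mod p = c} = (\<lambda>q. q * p + c) ` {..<m}"
  proof (intro equalityI subsetI)
    fix j assume j: "j \<in> {j. j < p * m \<and> j mod p = c}"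
    then have "j = (j div p) * p + c" by (metis (mono_tags, lifting) div_mult_mod_eq mem_Collect_eq)
    moreover have "j div p < m" using j by (simp add: less_mult_imp_div_less mult.commute)
    ultimately show "j \<in> (\<lambda>q. q * p + c) ` {..<m}" by blast
  next
    fix j assume "j \<in> (\<lambda>q. q * p + c) ` {..<m}"
    then obtain q where "q < m" "j = q * p + c" by blast
    then show "j \<in> {j. j < p * m \<and> j mod p = c}"
      using assms block_index_less[of q m c p] by (simp add: mult.commute)
  qed
  moreover have "inj_on (\<lambda>q. q * p + c) {..<m}" using assms by (intro inj_onI) simp
  ultimately show ?thesis by (simp add: card_image)
qed

text \<open>When $e^{i\kappa} = \pm 1$ the set of $p$-th roots of $e^{i\kappa}$ is closed under inversion.\<close>

lemma free_root_inverse: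
  assumes "cis (2 * \<kappa>) = 1" "p > 0"
  obtains j' where "free_root p \<kappa> j' = inverse (free_root p \<kappa> j)"
proof -
  have "cos (2 * \<kappa>) = 1" using assms(1) by (simp add: complex_eq_iff)
  then obtain t :: int where t: "2 * \<kappa> = real_of_int t * 2 * pi" by (auto simp: cos_one_2pi_int)
  define j' where "j' = nat ((- t - int j) mod int p)"
  define l where "l = (- t - int j) div int p"
  have "int j' = (- t - int j) mod int p" using assms(2) by (simp add: j'_def)
  then have "int j' = - t - int j - int p * l" by (simp add: l_def minus_mult_div_eq_mod)
  then have "real_of_int (int j') = real_of_int (- t - int j - int p * l)" by simp
  then have j': "real j' = - real_of_int t - real j - real p * real_of_int l" by simp
  have \<kappa>: "\<kappa> = real_of_int t * pi" using t by simp
  have quotient: "(- x + real p * y) / real p = - (x / real p) + y" for x y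
    using assms(2) by (simp add: field_simps)
  have shift: "\<kappa> + 2 * pi * real j' = - (\<kappa> + 2 * pi * real j) + real p * (2 * pi * real_of_int (- l))"
    unfolding j' \<kappa> by (simp add: algebra_simps)
  have "(\<kappa> + 2 * pi * real j') / real p = - ((\<kappa> + 2 * pi * real j) / real p) + 2 * pi * real_of_int (- l)"
    unfolding shift by (rule quotient)
  then have "free_root p \<kappa> j' = cis (- ((\<kappa> + 2 * pi * real j) / real p) + 2 * pi * real_of_int (- l))"
    by (simp add: free_root_def)
  also have "\<dots> = inverse (free_root p \<kappa> j)"
    unfolding cis_mult[symmetric] free_root_def using cis_multiple_2pi[of "real_of_int (- l)"]
    by (simp del: of_int_minus)
  finally show ?thesis using that by blast
qed

text \<open>The eigenvalue $z + z^{-1}$ occurs once for each index in the residue class modulo $p$ belonging to $z$, that is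
  $m$ times. If $e^{i\kappa} = \pm 1$, the root $z^{-1}$ yields the same eigenvalue, and it is a
  second residue class unless $z = \pm 1$, where the eigenvalue is $\pm 2$.\<close>

lemma free_multiplicity:
  fixes \<kappa> :: real and j :: nat
  assumes m: "m \<ge> 1" and p: "p \<ge> 3"
  defines "\<mu> \<equiv> complex_of_real (2 * cos ((\<kappa> + 2 * pi * real j) / real p))"
  assumes ne: "cis (2 * \<kappa>) = 1 \<Longrightarrow> \<mu> \<noteq> 2 \<and> \<mu> \<noteq> - 2"
  shows "[:- \<mu>, 1:] ^ (if cis (2 * \<kappa>) = 1 then 2 * m else m) dvd char_poly (K_free m p (cis \<kappa>))"
proof -
  have p0: "p > 0" using p by simp
  define ev where "ev = (\<lambda>j. complex_of_real (2 * cos ((\<kappa> + 2 * pi * real j) / real p)))"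
  define R where "R = (\<lambda>c. {i. i < p * m \<and> i mod p = c mod p})"
  have cR: "card (R c) = m" for c
    unfolding R_def using card_residue_class[of "c mod p" p m] p0 by simp
  have ev: "ev i = free_root p \<kappa> i + inverse (free_root p \<kappa> i)" for i
    by (simp only: ev_def free_root_plus_inverse)
  have evR: "ev i = ev c" if "i \<in> R c" for i c
    using that free_root_eq_mod[OF _ p0, of i c \<kappa>] by (simp add: ev R_def)
  have \<mu>: "\<mu> = ev j" by (simp add: \<mu>_def ev_def)
  have dvd: "[:- \<mu>, 1:] ^ card S dvd char_poly (K_free m p (cis \<kappa>))"
    if "S \<subseteq> {..<p * m}" "\<And>i. i \<in> S \<Longrightarrow> ev i = \<mu>" for S
  proof -
    have "[:- \<mu>, 1:] ^ card S = (\<Prod>i\<in>S. [:- ev i, 1:])" using that(2) by simp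
    also have "\<dots> dvd (\<Prod>i<p * m. [:- ev i, 1:])" by (rule prod_dvd_prod_subset[OF _ that(1)]) simp
    finally show ?thesis unfolding char_poly_K_free[OF m p] ev_def .
  qed
  show ?thesis
  proof (cases "cis (2 * \<kappa>) = 1")
    case False
    then show ?thesis using dvd[of "R j"] evR cR by (auto simp: \<mu> R_def)
  next
    case True
    obtain j' where j': "free_root p \<kappa> j' = inverse (free_root p \<kappa> j)"
      using free_root_inverse[OF True p0] .
    have ev': "ev j' = \<mu>" unfolding \<mu> ev j' by (simp add: add.commute)
    have "j mod p \<noteq> j' mod p"
    proof
      assume "j mod p = j' mod p"
      then have "free_root p \<kappa> j = inverse (free_root p \<kappa> j)"
        using free_root_eq_mod[OF _ p0, of j j' \<kappa>] j' by simp
      then have "(free_root p \<kappa> j)\<^sup>2 = 1"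
        using free_root_nonzero[of p \<kappa> j] by (simp add: power2_eq_square field_simps)
      then have "free_root p \<kappa> j = 1 \<or> free_root p \<kappa> j = - 1" by (simp add: power2_eq_1_iff)
      then have "\<mu> = 2 \<or> \<mu> = - 2" unfolding \<mu> ev by auto
      then show False using ne[OF True] by blast
    qed
    then have "R j \<inter> R j' = {}" by (auto simp: R_def)
    then have "card (R j \<union> R j') = 2 * m"
      using card_Un_disjoint[of "R j" "R j'"] cR by (auto simp: R_def)
    moreover have "ev i = \<mu>" if "i \<in> R j \<union> R j'" for i
      using that evR[of i j] evR[of i j'] ev' \<mu> by auto
    ultimately show ?thesis using dvd[of "R j \<union> R j'"] True by (auto simp: R_def)
  qed
qed

lemma eigenvalue_numbering_multiplicity:
  assumes "eigenvalue_numbering A lam" "N \<le> dim_row A" "\<And>n. n \<in> {1..N} \<Longrightarrow> lam n = \<mu>"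
  shows "[:- \<mu>, 1:] ^ N dvd char_poly A"
proof -
  have "[:- \<mu>, 1:] ^ N = (\<Prod>n = 1..N. [:- lam n, 1:])" using assms(3) by simp
  also have "\<dots> dvd (\<Prod>n = 1..dim_row A. [:- lam n, 1:])"
    by (rule prod_dvd_prod_subset) (use assms(2) in auto)
  finally show ?thesis using assms(1) by (simp add: eigenvalue_numbering_def)
qed

lemma multiplicity_eigenvalue_numbering:
  fixes A :: "complex mat"
  assumes A: "A \<in> carrier_mat n n" and dvd: "[:- \<mu>, 1:] ^ N dvd char_poly A"
  obtains lam where "eigenvalue_numbering A lam" "\<And>n. n \<in> {1..N} \<Longrightarrow> lam n = \<mu>"
proof -
  obtain es where es: "char_poly A = (\<Prod>e\<leftarrow>replicate N \<mu> @ es. [:- e, 1:])" and n: "N + length es = n"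
    using char_poly_splits_with_multiplicity[OF A dvd] .
  have "eigenvalue_numbering A (\<lambda>n. (replicate N \<mu> @ es) ! (n - 1))"
    by (rule eigenvalue_numbering_nth[OF es]) (use n A in auto)
  moreover have "(replicate N \<mu> @ es) ! (n - 1) = \<mu>" if "n \<in> {1..N}" for n
    using that by (auto simp: nth_append)
  ultimately show ?thesis using that by blast
qed

text \<open>Already one of the first two angles works: they differ by $2\pi/p < \pi$, so they cannot both be multiples
  of $\pi$.\<close>

lemma ex_interior_free_eigenvalue:
  fixes \<kappa> :: real
  assumes "p \<ge> 3"
  shows "\<exists>n\<in>{1..p}. complex_of_real (2 * cos ((\<kappa> + 2 * pi * real n) / real p)) \<noteq> 2 \<and>
    complex_of_real (2 * cos ((\<kappa> + 2 * pi * real n) / real p)) \<noteq> - 2"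
proof (rule ccontr)
  define \<theta> where "\<theta> = (\<lambda>n. (\<kappa> + 2 * pi * real n) / real p)"
  assume "\<not> ?thesis"
  then have "complex_of_real (2 * cos (\<theta> n)) = complex_of_real 2 \<or>
      complex_of_real (2 * cos (\<theta> n)) = complex_of_real (- 2)" if "n \<in> {1..p}" for n
    using that unfolding \<theta>_def by auto
  then have "2 * cos (\<theta> n) = 2 \<or> 2 * cos (\<theta> n) = - 2" if "n \<in> {1..p}" for n
    using that unfolding of_real_eq_iff by blast
  then have c: "cos (\<theta> n) = 1 \<or> cos (\<theta> n) = - 1" if "n \<in> {1..p}" for n
    using that by fastforce
  have s: "sin (\<theta> n) = 0" if "n \<in> {1..p}" for n
  proof -
    have "(sin (\<theta> n))\<^sup>2 = 0" unfolding sin_squared_eq using c[OF that] by auto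
    then show ?thesis by simp
  qed
  have "\<theta> 2 = \<theta> 1 + 2 * pi / real p" unfolding \<theta>_def using assms by (simp add: field_simps)
  then have "0 = cos (\<theta> 1) * sin (2 * pi / real p)"
    using s[of 1] s[of 2] assms by (simp add: sin_add)
  then have "sin (2 * pi / real p) = 0" using c[of 1] assms by auto
  moreover have "0 < 2 * pi / real p" "2 * pi / real p < pi"
    using assms by (simp_all add: field_simps)
  ultimately show False using sin_gt_zero by fastforce
qed

context periodic_jacobi
begin

lemma jacobi_op_free_iff: "jacobi_op m a b = free_jacobi_op m \<longleftrightarrow> (\<forall>n. a n = 1\<^sub>m m \<and> b n = 0\<^sub>m m m)"
  by (rule jacobi_op_eq_free_iff[OF a_carrier b_carrier])

lemma free_coefficients:
  assumes "jacobi_op m a b = free_jacobi_op m"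
  shows "K = K_free m p" "trace_sq = 2 * real p * real m"
proof -
  have "a = (\<lambda>_. 1\<^sub>m m)" "b = (\<lambda>_. 0\<^sub>m m m)" using assms unfolding jacobi_op_free_iff by auto
  then show "K = K_free m p" "trace_sq = 2 * real p * real m"
    using trace_sq_free[OF m_pos p_ge] by simp_all
qed

lemma free_spectrum_iff:
  "(\<exists>lam. eigenvalue_numbering (K (cis \<kappa>)) lam \<and>
      (\<forall>s\<in>{1..m * p}. lam s = complex_of_real (2 * cos ((\<kappa> + 2 * pi * (real s - 1)) / real p))))
    \<longleftrightarrow> char_poly (K (cis \<kappa>)) = char_poly (K_free m p (cis \<kappa>))"
proof -
  define ev where "ev = (\<lambda>s. complex_of_real (2 * cos ((\<kappa> + 2 * pi * (real s - 1)) / real p)))"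
  have dim: "dim_row (K (cis \<kappa>)) = m * p" using K_carrier[of "cis \<kappa>"] by simp
  have f: "char_poly (K_free m p (cis \<kappa>)) = (\<Prod>s = 1..m * p. [:- ev s, 1:])"
    unfolding char_poly_K_free[OF m_pos p_ge] ev_def
    by (simp add: prod.atLeast1_atMost_eq mult.commute)
  have "(\<exists>lam. eigenvalue_numbering (K (cis \<kappa>)) lam \<and> (\<forall>s\<in>{1..m * p}. lam s = ev s))
      \<longleftrightarrow> char_poly (K (cis \<kappa>)) = (\<Prod>s = 1..m * p. [:- ev s, 1:])"
    unfolding eigenvalue_numbering_def dim by (metis (no_types, lifting) prod.cong)
  then show ?thesis unfolding f ev_def .
qed

lemma trace_sq_if_free_char_poly:
  assumes "cmod \<tau> = 1" "char_poly (K \<tau>) = char_poly (K_free m p \<tau>)"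
  shows "trace_sq = 2 * real p * real m"
proof -
  interpret free: periodic_jacobi m p "\<lambda>_. 1\<^sub>m m" "\<lambda>_. 0\<^sub>m m m"
    by (rule periodic_jacobi_free[OF m_pos p_ge])
  obtain lam where lam: "eigenvalue_numbering (K \<tau>) lam" using ex_eigenvalue_numbering by blast
  then have "eigenvalue_numbering (K_free m p \<tau>) lam"
    using assms(2) K_carrier[of \<tau>] free.K_carrier[of \<tau>] by (simp add: eigenvalue_numbering_def)
  then have "complex_of_real trace_sq = complex_of_real free.trace_sq"
    using eigenvalue_square_sum[OF assms(1) lam] free.eigenvalue_square_sum[OF assms(1)] by simp
  then show ?thesis unfolding of_real_eq_iff trace_sq_free[OF m_pos p_ge] .
qed

lemma free_iff_square_sum:
  assumes c: "det (period_product m p a) = 1"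
  shows "(\<exists>\<tau> lam. cmod \<tau> = 1 \<and> eigenvalue_numbering (K \<tau>) lam \<and>
      (\<Sum>n = 1..m * p. (lam n)\<^sup>2) = complex_of_real (2 * real p * real m))
    \<longleftrightarrow> jacobi_op m a b = free_jacobi_op m" (is "?L \<longleftrightarrow> ?R")
proof
  assume ?L
  then have "trace_sq = 2 * real p * real m"
    using eigenvalue_square_sum by (metis of_real_eq_iff)
  then show ?R unfolding jacobi_op_free_iff using free_if_trace_sq_minimal[OF c] by blast
next
  assume ?R
  note E = free_coefficients(2)[OF this]
  obtain lam where lam: "eigenvalue_numbering (K 1) lam" using ex_eigenvalue_numbering by blast
  have one: "cmod 1 = 1" by simp
  show ?L using eigenvalue_square_sum[OF one lam] lam one unfolding E by blast
qed

lemma free_iff_char_poly: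
  assumes c: "det (period_product m p a) = 1"
  shows "char_poly (K (cis \<kappa>)) = char_poly (K_free m p (cis \<kappa>))
    \<longleftrightarrow> jacobi_op m a b = free_jacobi_op m"
proof
  assume "char_poly (K (cis \<kappa>)) = char_poly (K_free m p (cis \<kappa>))"
  then have "trace_sq = 2 * real p * real m" by (intro trace_sq_if_free_char_poly) simp_all
  then show "jacobi_op m a b = free_jacobi_op m"
    unfolding jacobi_op_free_iff using free_if_trace_sq_minimal[OF c] by blast
qed (simp add: free_coefficients(1))

text \<open>The operator and the free one have the same characteristic polynomial at $e^{i\kappa_1}$ and share an
  eigenvalue of full multiplicity at $e^{i\kappa_2}$. Evaluating the determinant formula at
  that eigenvalue for both operators leaves only the factor $c$ to compare. The condition
  $\mu \ne \pm 2$ ensures the double multiplicity on the free side when $e^{i\kappa_2} = \pm 1$.\<close>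

lemma det_period_product_if_two_spectra:
  fixes \<kappa>1 \<kappa>2 :: real and j :: nat
  defines "\<mu> \<equiv> complex_of_real (2 * cos ((\<kappa>2 + 2 * pi * real j) / real p))"
  assumes cos: "cos \<kappa>1 \<noteq> cos \<kappa>2"
    and spec: "char_poly (K (cis \<kappa>1)) = char_poly (K_free m p (cis \<kappa>1))"
    and mult: "[:- \<mu>, 1:] ^ (if cis (2 * \<kappa>2) = 1 then 2 * m else m) dvd char_poly (K (cis \<kappa>2))"
    and ne: "cis (2 * \<kappa>2) = 1 \<Longrightarrow> \<mu> \<noteq> 2 \<and> \<mu> \<noteq> - 2"
  shows "det (period_product m p a) = 1"
proof -
  interpret free: periodic_jacobi m p "\<lambda>_. 1\<^sub>m m" "\<lambda>_. 0\<^sub>m m m"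
    by (rule periodic_jacobi_free[OF m_pos p_ge])
  have free_mult: "[:- \<mu>, 1:] ^ (if cis (2 * \<kappa>2) = 1 then 2 * m else m) dvd char_poly (K_free m p (cis \<kappa>2))"
    unfolding \<mu>_def by (rule free_multiplicity[OF m_pos p_ge]) (use ne in \<open>simp add: \<mu>_def\<close>)
  have "det (period_product m p (\<lambda>_. 1\<^sub>m m)) = 1"
    unfolding free.det_period_product by simp
  then have "det (period_product m p a) * \<bar>2 * cos \<kappa>1 - 2 * cos \<kappa>2\<bar> ^ m = \<bar>2 * cos \<kappa>1 - 2 * cos \<kappa>2\<bar> ^ m"
    using norm_char_poly_at_full_multiplicity[OF mult[unfolded \<mu>_def], of \<kappa>1]
      free.norm_char_poly_at_full_multiplicity[OF free_mult[unfolded \<mu>_def], of \<kappa>1]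
    unfolding spec by simp
  then show ?thesis using cos by simp
qed

end

theorem theorem1p2:
  fixes m p :: nat and a b :: "int \<Rightarrow> real mat"
  assumes "m \<ge> 1" and "p \<ge> 3"
    and "\<And>n. positive_definite m (a n)"
    and "\<And>n. self_adjoint m (b n)"
    and "\<And>n. a (n + int p) = a n"
    and "\<And>n. b (n + int p) = b n"
  shows
    "(det (period_product m p a) = 1 \<longrightarrow>
       ((\<exists>\<tau> lam. cmod \<tau> = 1 \<and> eigenvalue_numbering (K_mat m p a b \<tau>) lam \<and>
           (\<Sum>n = 1..m * p. (lam n)\<^sup>2) = complex_of_real (2 * real p * real m))
        \<longleftrightarrow> jacobi_op m a b = free_jacobi_op m))
     \<and>
     (det (period_product m p a) = 1 \<longrightarrow> (\<forall>\<kappa>1 :: real.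
       (\<exists>lam. eigenvalue_numbering (K_mat m p a b (cis \<kappa>1)) lam \<and>
           (\<forall>s \<in> {1..m * p}. lam s =
              complex_of_real (2 * cos ((\<kappa>1 + 2 * pi * (real s - 1)) / real p))))
        \<longleftrightarrow> jacobi_op m a b = free_jacobi_op m))
     \<and>
     (\<forall>\<kappa>1 \<kappa>2 :: real. cos \<kappa>1 \<noteq> cos \<kappa>2 \<longrightarrow>
       ((\<exists>lam. eigenvalue_numbering (K_mat m p a b (cis \<kappa>1)) lam \<and>
           (\<forall>s \<in> {1..m * p}. lam s =
              complex_of_real (2 * cos ((\<kappa>1 + 2 * pi * (real s - 1)) / real p))))
        \<and>
        (\<exists>n1 \<in> {1..p}. \<exists>lam. eigenvalue_numbering (K_mat m p a b (cis \<kappa>2)) lam \<and>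
           (\<forall>n \<in> {1..m}. lam n =
              complex_of_real (2 * cos ((\<kappa>2 + 2 * pi * real n1) / real p))) \<and>
           (cis (2 * \<kappa>2) = 1 \<longrightarrow>
              (\<forall>n \<in> {1..m}. lam (n + m) = lam 1 \<and> lam 1 \<noteq> 2 \<and> lam 1 \<noteq> - 2)))
        \<longleftrightarrow> jacobi_op m a b = free_jacobi_op m))"
proof -
  interpret periodic_jacobi m p a b using assms by unfold_locales
  show ?thesis
  proof (intro conjI impI allI)
    assume "det (period_product m p a) = 1"
    then show "(\<exists>\<tau> lam. cmod \<tau> = 1 \<and> eigenvalue_numbering (K \<tau>) lam \<and>
        (\<Sum>n = 1..m * p. (lam n)\<^sup>2) = complex_of_real (2 * real p * real m))
      \<longleftrightarrow> jacobi_op m a b = free_jacobi_op m"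
      by (rule free_iff_square_sum)
  next
    fix \<kappa>1 :: real
    assume "det (period_product m p a) = 1"
    then show "(\<exists>lam. eigenvalue_numbering (K (cis \<kappa>1)) lam \<and>
        (\<forall>s \<in> {1..m * p}. lam s = complex_of_real (2 * cos ((\<kappa>1 + 2 * pi * (real s - 1)) / real p))))
      \<longleftrightarrow> jacobi_op m a b = free_jacobi_op m"
      unfolding free_spectrum_iff by (rule free_iff_char_poly)
  next
    fix \<kappa>1 \<kappa>2 :: real
    assume cos: "cos \<kappa>1 \<noteq> cos \<kappa>2"
    define \<mu> where "\<mu> = (\<lambda>n. complex_of_real (2 * cos ((\<kappa>2 + 2 * pi * real n) / real p)))"
    define N where "N = (if cis (2 * \<kappa>2) = 1 then 2 * m else m)"
    let ?A = "char_poly (K (cis \<kappa>1)) = char_poly (K_free m p (cis \<kappa>1))"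
    let ?B = "\<exists>n1 \<in> {1..p}. \<exists>lam. eigenvalue_numbering (K (cis \<kappa>2)) lam \<and>
           (\<forall>n \<in> {1..m}. lam n = \<mu> n1) \<and>
           (cis (2 * \<kappa>2) = 1 \<longrightarrow>
              (\<forall>n \<in> {1..m}. lam (n + m) = lam 1 \<and> lam 1 \<noteq> 2 \<and> lam 1 \<noteq> - 2))"
    let ?J = "jacobi_op m a b = free_jacobi_op m"
    have "?A \<and> ?B \<longleftrightarrow> ?J"
    proof
      assume AB: "?A \<and> ?B"
      then obtain n1 lam where lam: "eigenvalue_numbering (K (cis \<kappa>2)) lam"
        and l1: "\<And>n. n \<in> {1..m} \<Longrightarrow> lam n = \<mu> n1"
        and l2: "\<And>n. cis (2 * \<kappa>2) = 1 \<Longrightarrow> n \<in> {1..m} \<Longrightarrow> lam (n + m) = lam 1 \<and> lam 1 \<noteq> 2 \<and> lam 1 \<noteq> - 2"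
        by blast
      have one: "1 \<in> {1..m}" using m_pos by simp
      have lN: "lam n = \<mu> n1" if "n \<in> {1..N}" for n
      proof (cases "n \<le> m")
        case True
        then show ?thesis using l1[of n] that by simp
      next
        case False
        then have "cis (2 * \<kappa>2) = 1" "n - m \<in> {1..m}"
          using that by (auto simp: N_def split: if_splits)
        from l2[OF this] show ?thesis using l1[OF one] False by simp
      qed
      have "2 * m \<le> p * m" using p_ge by (intro mult_le_mono1) simp
      then have "N \<le> dim_row (K (cis \<kappa>2))"
        using K_carrier[of "cis \<kappa>2"] p_ge by (auto simp: N_def)
      from eigenvalue_numbering_multiplicity[OF lam this lN]
      have mult: "[:- \<mu> n1, 1:] ^ N dvd char_poly (K (cis \<kappa>2))" .
      have ne: "\<mu> n1 \<noteq> 2 \<and> \<mu> n1 \<noteq> - 2" if "cis (2 * \<kappa>2) = 1"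
        using l2[OF that one] l1[OF one] by simp
      have "det (period_product m p a) = 1"
        using det_period_product_if_two_spectra[OF cos, of n1] AB mult ne
        unfolding N_def \<mu>_def by blast
      from free_iff_char_poly[OF this] AB show ?J by blast
    next
      assume J: ?J
      note KF = free_coefficients(1)[OF J]
      obtain n1 where n1: "n1 \<in> {1..p}" and ne: "\<mu> n1 \<noteq> 2 \<and> \<mu> n1 \<noteq> - 2"
        using ex_interior_free_eigenvalue[OF p_ge, of \<kappa>2] unfolding \<mu>_def by blast
      have "[:- \<mu> n1, 1:] ^ N dvd char_poly (K (cis \<kappa>2))"
        unfolding N_def \<mu>_def KF by (rule free_multiplicity[OF m_pos p_ge]) (use ne in \<open>simp add: \<mu>_def\<close>)
      then obtain lam where lam: "eigenvalue_numbering (K (cis \<kappa>2)) lam"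
        and lN: "\<And>n. n \<in> {1..N} \<Longrightarrow> lam n = \<mu> n1"
        using multiplicity_eigenvalue_numbering[OF K_carrier] by blast
      have l1: "lam n = \<mu> n1" if "n \<in> {1..m}" for n using lN[of n] that by (simp add: N_def)
      have l2: "lam (n + m) = \<mu> n1" if "cis (2 * \<kappa>2) = 1" "n \<in> {1..m}" for n
        using lN[of "n + m"] that by (simp add: N_def)
      have l0: "lam 1 = \<mu> n1" using l1[of 1] m_pos by simp
      have ?B
      proof (intro bexI[OF _ n1] exI[of _ lam] conjI ballI impI)
        show "eigenvalue_numbering (K (cis \<kappa>2)) lam" by (rule lam)
      qed (use l0 l1 l2 ne in simp_all)
      then show "?A \<and> ?B" using KF by simp
    qed
    then show "(\<exists>lam. eigenvalue_numbering (K (cis \<kappa>1)) lam \<and>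
           (\<forall>s \<in> {1..m * p}. lam s =
              complex_of_real (2 * cos ((\<kappa>1 + 2 * pi * (real s - 1)) / real p))))
        \<and>
        (\<exists>n1 \<in> {1..p}. \<exists>lam. eigenvalue_numbering (K (cis \<kappa>2)) lam \<and>
           (\<forall>n \<in> {1..m}. lam n =
              complex_of_real (2 * cos ((\<kappa>2 + 2 * pi * real n1) / real p))) \<and>
           (cis (2 * \<kappa>2) = 1 \<longrightarrow>
              (\<forall>n \<in> {1..m}. lam (n + m) = lam 1 \<and> lam 1 \<noteq> 2 \<and> lam 1 \<noteq> - 2)))
        \<longleftrightarrow> ?J"
      unfolding free_spectrum_iff \<mu>_def .
  qed
qed

end
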